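(* The minimum of $f(b_1,b_2,b_{12})$ over all feasible configurations $(b_1,b_2,b_{12})$ is attained at a point of the form $(b^*,b^*,-1+2|b^*|)$ for some $b^*$ with $|b^*|\in[b_0-\varepsilon,b_0+\varepsilon]$, where $b_0=0.1489442$ and $\varepsilon=10^{-6}$.
   Context: $\Phi$ denotes the standard normal CDF, with $\Phi^{-1}(0)=-\infty$, $\Phi^{-1}(1)=+\infty$. For $\rho\in[-1,1]$, $\Phi_\rho(x,y)=\Pr[X\le x,\,Y\le y]$ for jointly Gaussian standard normals $X,Y$ with correlation $\rho$. A configuration is a triple $(b_1,b_2,b_{12})\in[-1,1]^3$; $\rho(b_1,b_2,b_{12})=\frac{b_{12}-b_1b_2}{\sqrt{(1-b_1^2)(1-b_2^2)}}$ if the denominator is nonzero and $0$ otherwise. It is feasible if there are unit vectors $\mathbf v_0,\mathbf v_1,\mathbf v_2$ with $\mathbf v_0\cdot\mathbf v_1=b_1$, $\mathbf v_0\cdot\mathbf v_2=b_2$, $\mathbf v_1\cdot\mathbf v_2=b_{12}$, and $-1+|b_1+b_2|\le b_{12}\le 1-|b_1-b_2|$. $\mathsf{Value}(b_1,b_2,b_{12})=\frac{3-b_1-b_2-b_{12}}{4}$. Here $f(b_1,b_2,b_{12})=1-\Phi_\rho\big(\Phi^{-1}(\tfrac{1+b_1}{2}),\Phi^{-1}(\tfrac{1+b_2}{2})\big)-\mathsf{Value}(b_1,b_2,b_{12})$ with $\rho=\rho(b_1,b_2,b_{12})$. *)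

theory Defs
  imports "HOL-Probability.Probability"
begin

definition std_normal :: "real measure" where
  "std_normal = density lborel (\<lambda>x. ennreal (std_normal_density x))"

definition Phi :: "real \<Rightarrow> real" where
  "Phi x = measure std_normal {..x}"

definition Phi_inv :: "real \<Rightarrow> ereal" where
  "Phi_inv p = (if p \<le> 0 then -\<infinity> else if p \<ge> 1 then \<infinity> else ereal (THE x. Phi x = p))"

text \<open>Bivariate standard normal CDF with correlation rho in [-1,1]:
  X = Z1, Y = rho Z1 + sqrt(1-rho^2) Z2 with Z1, Z2 independent standard normals;
  arguments are extended reals so that infinite thresholds are allowed.\<close>
definition Phi2 :: "real \<Rightarrow> ereal \<Rightarrow> ereal \<Rightarrow> real" where
  "Phi2 \<rho> x y = measure (std_normal \<Otimes>\<^sub>M std_normal)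
     {z. ereal (fst z) \<le> x \<and> ereal (\<rho> * fst z + sqrt (1 - \<rho>\<^sup>2) * snd z) \<le> y}"

definition rho_cfg :: "real \<Rightarrow> real \<Rightarrow> real \<Rightarrow> real" where
  "rho_cfg b1 b2 b12 =
     (if sqrt ((1 - b1\<^sup>2) * (1 - b2\<^sup>2)) \<noteq> 0
      then (b12 - b1 * b2) / sqrt ((1 - b1\<^sup>2) * (1 - b2\<^sup>2)) else 0)"

definition feasible :: "real \<Rightarrow> real \<Rightarrow> real \<Rightarrow> bool" where
  "feasible b1 b2 b12 \<longleftrightarrow>
     b1 \<in> {-1..1} \<and> b2 \<in> {-1..1} \<and> b12 \<in> {-1..1} \<and>
     (\<exists>v0 v1 v2 :: real^3. norm v0 = 1 \<and> norm v1 = 1 \<and> norm v2 = 1 \<and>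
        v0 \<bullet> v1 = b1 \<and> v0 \<bullet> v2 = b2 \<and> v1 \<bullet> v2 = b12) \<and>
     -1 + \<bar>b1 + b2\<bar> \<le> b12 \<and> b12 \<le> 1 - \<bar>b1 - b2\<bar>"

definition Value :: "real \<Rightarrow> real \<Rightarrow> real \<Rightarrow> real" where
  "Value b1 b2 b12 = (3 - b1 - b2 - b12) / 4"

definition f_cfg :: "real \<Rightarrow> real \<Rightarrow> real \<Rightarrow> real" where
  "f_cfg b1 b2 b12 =
     1 - Phi2 (rho_cfg b1 b2 b12) (Phi_inv ((1 + b1) / 2)) (Phi_inv ((1 + b2) / 2))
       - Value b1 b2 b12"

end

theory Submission
  imports Defs
begin

text \<open>
  Let \<open>t\<^sub>i\<close> be the threshold with \<open>b\<^sub>i = 2 \<Phi>(t\<^sub>i) - 1\<close> and write \<open>\<Psi> = \<Phi> - 1/2\<close> and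
  \<open>\<sigma> = sqrt (\<Phi> (1 - \<Phi>))\<close>. Integrating the bivariate density over the correlation gives
  \<open>f = \<rho> \<sigma>(t\<^sub>1) \<sigma>(t\<^sub>2) - \<integral>\<^sub>0\<^sup>\<rho> \<phi>\<^sub>s(t\<^sub>1, t\<^sub>2) ds\<close>. For \<open>\<rho> \<ge> 0\<close> this is nonnegative (Gebelein's
  inequality), so let \<open>\<rho> = - r < 0\<close> and maximise \<open>- f\<close>, where by symmetry \<open>x = (t\<^sub>1 + t\<^sub>2)/2 \<ge> 0\<close>.
  For fixed \<open>r\<close> and \<open>x\<close> the maximum over \<open>y = (t\<^sub>1 - t\<^sub>2)/2\<close> is at \<open>y = 0\<close>: this reduces to
  \<open>\<sigma>(x + y) \<sigma>(x - y) + exp(- x\<^sup>2) \<Psi>(y)\<^sup>2 \<le> \<sigma>(x)\<^sup>2\<close>, while log-odds concavity shows that feasibility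
  survives the move to equal thresholds. For equal thresholds and fixed \<open>r \<ge> 5/11\<close> the loss increases
  in \<open>x\<close> up to the boundary of the feasible region, and for \<open>r \<le> 5/11\<close> it is below the optimum.
  On the boundary curve \<open>b\<^sub>1\<^sub>2 = 2 b - 1\<close> the sign of the derivative is that of a monotone function of
  the threshold, whose zero is located numerically.
\<close>

section \<open>The standard normal distribution\<close>

text \<open>What makes the estimates tractable: in the coordinates \<open>x\<close>,
  \<open>y\<close> the exponent of the bivariate density is diagonal, and its derivative along an
  axis or along one threshold, integrated over the correlation, has a primitive in terms of
  \<open>Psi\<close>. Derivatives of the loss are therefore free of integrals, and their signs come
  down to comparing \<open>Psi\<close> at scaled arguments. Correlation and thresholds are the right
  variables for the constraint too: \<open>- 1 + b1 + b2 <= b12\<close> reads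
  \<open>4 * r * sd u * sd t <= (1 - b1) * (1 - b2)\<close>. Squared, it bounds \<open>r^2\<close>
  by the product of the odds \<open>(1 - Phi) / Phi\<close> at both thresholds, which is why
  log-odds enter. The obstacle is the move to the boundary. With
  \<open>b = (1 - r) / (1 + r)\<close>, the boundary value of \<open>2 * Psi x\<close>, the loss
  stops increasing in \<open>x\<close> before the boundary when \<open>b\<close> is near 1. The sign
  estimate used here reaches \<open>b = 3 / 8\<close>, that is \<open>r = 5 / 11\<close>; for
  smaller \<open>r\<close> a crude bound \<open>0.055\<close> is enough, because an explicit point
  already has at least that loss.\<close>

abbreviation phi :: "real \<Rightarrow> real" where
  "phi \<equiv> std_normal_density"

lemma phi_eq: "phi x = exp (- (x\<^sup>2 / 2)) / sqrt (2 * pi)"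
  by (simp add: std_normal_density_def)

lemma phi_pos: "0 < phi x"
  by (simp add: normal_density_pos)

lemma phi_minus [simp]: "phi (- x) = phi x"
  by (simp add: phi_eq)

lemma phi_deriv [derivative_intros]:
  assumes "(g has_real_derivative g') (at x within S)"
  shows "((\<lambda>x. phi (g x)) has_real_derivative - g x * phi (g x) * g') (at x within S)"
proof -
  have *: "phi = (\<lambda>x. (1 / sqrt (2 * pi)) * exp (- (x\<^sup>2 / 2)))"
    by (simp add: phi_eq fun_eq_iff)
  show ?thesis
    unfolding * by (rule derivative_eq_intros assms refl | simp)+
qed

lemma phi_mult: "phi x * phi y = exp (- ((x\<^sup>2 + y\<^sup>2) / 2)) / (2 * pi)"
proof -
  have "sqrt (2 * pi) * sqrt (2 * pi) = 2 * pi"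
    by simp
  then show ?thesis
    unfolding phi_eq by (simp add: exp_add[symmetric] add_divide_distrib)
qed

lemma isCont_phi: "isCont phi x"
  using DERIV_isCont[OF phi_deriv[OF DERIV_ident]] by simp

lemma continuous_on_phi [continuous_intros]:
  "continuous_on S g \<Longrightarrow> continuous_on S (\<lambda>x. phi (g x))"
  unfolding phi_eq by (intro continuous_intros) auto

lemma phi_antimono: "\<bar>x\<bar> \<le> \<bar>y\<bar> \<Longrightarrow> phi y \<le> phi x"
  unfolding phi_eq by (intro divide_right_mono) (auto simp: abs_le_square_iff)

lemma prob_space_std_normal: "prob_space std_normal"
  unfolding std_normal_def by (rule prob_space_normal_density) simp

lemma sets_std_normal [measurable_cong, simp]: "sets std_normal = sets borel"
  by (simp add: std_normal_def)

lemma space_std_normal [simp]: "space std_normal = UNIV"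
  by (simp add: std_normal_def)

lemma measure_std_normal:
  assumes "A \<in> sets borel"
  shows "measure std_normal A = (LINT x:A|lborel. phi x)"
proof -
  interpret prob_space std_normal by (rule prob_space_std_normal)
  have "measure std_normal A = (\<integral>x. indicator A x \<partial>std_normal)"
    using assms by simp
  also have "\<dots> = (\<integral>x. phi x * indicator A x \<partial>lborel)"
    unfolding std_normal_def using assms by (subst integral_density) auto
  finally show ?thesis
    by (simp add: set_lebesgue_integral_def mult.commute)
qed

lemma set_integrable_phi: "A \<in> sets borel \<Longrightarrow> set_integrable lborel A phi"
  unfolding set_integrable_def
  using integrable_mult_indicator[of A lborel phi] by simp

lemma Phi_nonneg: "0 \<le> Phi x" and Phi_le_1: "Phi x \<le> 1"
  by (auto simp: Phi_def intro: prob_space.prob_le_1[OF prob_space_std_normal])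

lemma Phi_diff:
  assumes "a \<le> b"
  shows "Phi b = Phi a + integral {a..b} phi"
proof -
  have "Phi b = (LINT x:{..a} \<union> {a<..b}|lborel. phi x)"
    unfolding Phi_def using assms by (simp add: measure_std_normal ivl_disj_un)
  also have "\<dots> = (LINT x:{..a}|lborel. phi x) + (LINT x:{a<..b}|lborel. phi x)"
    by (rule set_integral_Un) (auto intro: set_integrable_phi)
  also have "(LINT x:{a<..b}|lborel. phi x) = (LINT x:{a..b}|lborel. phi x)"
    unfolding set_lebesgue_integral_def
    by (rule integral_cong_AE) (auto intro!: AE_I[of _ _ "{a}"] simp: indicator_def)
  also have "(LINT x:{a..b}|lborel. phi x) = integral {a..b} phi"
    by (rule set_borel_integral_eq_integral) (auto intro: set_integrable_phi)
  finally show ?thesis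
    by (simp add: Phi_def measure_std_normal)
qed

lemma Phi_deriv_at: "(Phi has_real_derivative phi x) (at x)"
proof -
  have "((\<lambda>u. integral {x-1..u} phi) has_real_derivative phi x) (at x within {x-1..x+1})"
    by (rule integral_has_real_derivative) (auto intro!: continuous_intros)
  then have "((\<lambda>u. Phi (x-1) + integral {x-1..u} phi) has_real_derivative phi x)
      (at x within {x-1..x+1})"
    by (auto intro!: derivative_eq_intros)
  then have "(Phi has_real_derivative phi x) (at x within {x-1..x+1})"
    by (rule has_field_derivative_transform_within[of _ _ _ _ 1]) (auto intro: Phi_diff[symmetric])
  then show ?thesis
    using at_within_Icc_at[of "x-1" x "x+1"] by simp
qed

lemma Phi_minus: "Phi (- x) = 1 - Phi x"
proof -
  interpret prob_space std_normal by (rule prob_space_std_normal)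
  have "Phi (- x) = (\<integral>t. indicator {..-x} t * phi t \<partial>lborel)"
    by (simp add: Phi_def measure_std_normal set_lebesgue_integral_def)
  also have "\<dots> = (\<integral>t. indicator {..-x} (0 + (-1) * t) * phi (0 + (-1) * t) \<partial>lborel)"
    by (subst lborel_integral_real_affine[of "-1" _ 0]) auto
  also have "\<dots> = (\<integral>t. indicator {x<..} t * phi t \<partial>lborel)"
    by (rule integral_cong_AE) (auto intro!: AE_I[of _ _ "{x}"] simp: indicator_def)
  also have "\<dots> = measure std_normal {x<..}"
    by (simp add: measure_std_normal set_lebesgue_integral_def)
  also have "{x<..} = space std_normal - {..x}"
    by auto
  also have "measure std_normal \<dots> = 1 - Phi x"
    by (subst prob_compl) (auto simp: Phi_def)
  finally show ?thesis .
qed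

lemma Phi_strict_mono: "x < y \<Longrightarrow> Phi x < Phi y"
  by (rule DERIV_pos_imp_increasing[of x y Phi]) (use Phi_deriv_at phi_pos in blast)+

lemma Phi_tendsto_bot: "(Phi \<longlongrightarrow> 0) at_bot" and Phi_tendsto_top: "(Phi \<longlongrightarrow> 1) at_top"
proof -
  interpret std: real_distribution std_normal
    by (simp add: real_distribution_def real_distribution_axioms_def prob_space_std_normal)
  have *: "Phi = cdf std_normal"
    by (auto simp: Phi_def cdf_def)
  show "(Phi \<longlongrightarrow> 0) at_bot" "(Phi \<longlongrightarrow> 1) at_top"
    unfolding * by (rule std.cdf_lim_at_bot std.cdf_lim_at_top_prob)+
qed

lemma Phi_pos: "0 < Phi x" and Phi_less_1: "Phi x < 1"
  using Phi_strict_mono[of "x-1" x] Phi_strict_mono[of x "x+1"] Phi_nonneg[of "x-1"] Phi_le_1[of "x+1"]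
  by auto

lemma Phi_surj:
  assumes "0 < p" "p < 1"
  obtains x where "Phi x = p"
proof -
  have "\<forall>\<^sub>F x in at_bot. Phi x < p"
    using order_tendstoD(2)[OF Phi_tendsto_bot assms(1)] .
  then obtain a where a: "Phi a < p"
    by (auto simp: eventually_at_bot_linorder)
  have "\<forall>\<^sub>F x in at_top. p < Phi x"
    using order_tendstoD(1)[OF Phi_tendsto_top assms(2)] .
  then obtain b where b: "p < Phi b"
    by (auto simp: eventually_at_top_linorder)
  have "a \<le> b"
    using a b Phi_strict_mono[of b a] by (cases "a \<le> b") auto
  then obtain x where "Phi x = p"
    using IVT[of Phi a p b] a b DERIV_isCont[OF Phi_deriv_at] by force
  then show ?thesis by (rule that)
qed

lemma Phi_inj: "Phi x = Phi y \<longleftrightarrow> x = y"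
  using Phi_strict_mono[of x y] Phi_strict_mono[of y x] by (cases x y rule: linorder_cases) auto

lemma Phi_inv_Phi: "Phi_inv (Phi x) = ereal x"
  using Phi_pos[of x] Phi_less_1[of x] by (auto simp: Phi_inv_def Phi_inj)

section \<open>Centred distribution function and standard deviation of a threshold indicator\<close>

definition Psi :: "real \<Rightarrow> real" where
  "Psi x = Phi x - 1 / 2"

lemma Psi_deriv [derivative_intros]:
  assumes "(g has_real_derivative g') (at x within S)"
  shows "((\<lambda>x. Psi (g x)) has_real_derivative phi (g x) * g') (at x within S)"
  unfolding Psi_def
  using DERIV_chain2[OF Phi_deriv_at assms] by (auto intro!: derivative_eq_intros)

lemma Psi_minus [simp]: "Psi (- x) = - Psi x"
  by (simp add: Psi_def Phi_minus)

lemma Psi_0 [simp]: "Psi 0 = 0"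
  using Psi_minus[of 0] by simp

lemma Psi_strict_mono: "x < y \<Longrightarrow> Psi x < Psi y"
  by (simp add: Psi_def Phi_strict_mono)

lemma Psi_mono: "x \<le> y \<Longrightarrow> Psi x \<le> Psi y"
  using Psi_strict_mono[of x y] by (cases "x = y") auto

lemma Psi_nonneg: "0 \<le> x \<Longrightarrow> 0 \<le> Psi x" and Psi_pos: "0 < x \<Longrightarrow> 0 < Psi x"
  using Psi_mono[of 0 x] Psi_strict_mono[of 0 x] by auto

lemma Psi_less_half: "Psi x < 1 / 2" and Psi_gt_minus_half: "- 1 / 2 < Psi x"
  using Phi_pos[of x] Phi_less_1[of x] by (auto simp: Psi_def)

lemma abs_Psi: "\<bar>Psi x\<bar> = Psi \<bar>x\<bar>"
  using Psi_nonneg[of x] Psi_nonneg[of "-x"] by (cases "x \<ge> 0") auto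

lemma Psi_abs_less_half: "\<bar>Psi x\<bar> < 1 / 2"
  using Psi_less_half[of x] Psi_gt_minus_half[of x] by linarith

lemma Psi_sq_less: "(Psi x)\<^sup>2 < 1 / 4"
  using abs_square_less_1[of "2 * Psi x"] Psi_abs_less_half[of x]
  by (simp add: power_mult_distrib abs_mult)

lemma Psi_tendsto_top: "(Psi \<longlongrightarrow> 1 / 2) at_top"
proof -
  have "((\<lambda>x. Phi x - 1 / 2) \<longlongrightarrow> 1 - 1 / 2) at_top"
    by (intro tendsto_intros Phi_tendsto_top)
  then show ?thesis by (simp add: Psi_def[abs_def])
qed

text \<open>\<open>Psi\<close> is concave on the positive half-line and vanishes at 0.\<close>

lemma Psi_scale_le:
  assumes "0 \<le> x" "0 \<le> c" "c \<le> 1"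
  shows "c * Psi x \<le> Psi (c * x)"
proof -
  have "(\<lambda>x. Psi (c * x) - c * Psi x) 0 \<le> (\<lambda>x. Psi (c * x) - c * Psi x) x"
  proof (rule DERIV_nonneg_imp_nondecreasing[OF assms(1)])
    fix z assume "0 \<le> z" "z \<le> x"
    have "phi z \<le> phi (c * z)"
      using assms \<open>0 \<le> z\<close> by (intro phi_antimono) (auto simp: abs_mult mult_left_le_one_le)
    then have "0 \<le> phi (c * z) * c - c * phi z"
      using assms mult_left_mono[of "phi z" "phi (c * z)" c] by (simp add: mult.commute)
    moreover have "((\<lambda>x. Psi (c * x) - c * Psi x) has_real_derivative phi (c * z) * c - c * phi z) (at z)"
      by (auto intro!: derivative_eq_intros)
    ultimately show "\<exists>y. ((\<lambda>x. Psi (c * x) - c * Psi x) has_real_derivative y) (at z) \<and> 0 \<le> y"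
      by blast
  qed
  then show ?thesis by simp
qed

text \<open>Standard deviation of the indicator of \<open>X <= x\<close>. For
  \<open>b1 = 2 * Psi u\<close> and \<open>b2 = 2 * Psi t\<close> the denominator of
  \<open>rho_cfg\<close> is \<open>4 * (sd u * sd t)\<close>, so the correlation times
  \<open>sd u * sd t\<close> is \<open>(b12 - b1 * b2) / 4\<close>.\<close>

definition sd :: "real \<Rightarrow> real" where
  "sd x = sqrt (1 / 4 - (Psi x)\<^sup>2)"

lemma sd_pos: "0 < sd x"
  using Psi_sq_less[of x] by (simp add: sd_def)

lemma sd_sq: "(sd x)\<^sup>2 = 1 / 4 - (Psi x)\<^sup>2"
  using Psi_sq_less[of x] by (simp add: sd_def)

lemma sd_minus [simp]: "sd (- x) = sd x"
  by (simp add: sd_def)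

lemma sd_deriv [derivative_intros]:
  assumes "(g has_real_derivative g') (at x within S)"
  shows "((\<lambda>x. sd (g x)) has_real_derivative - (phi (g x) * Psi (g x) / sd (g x)) * g') (at x within S)"
  unfolding sd_def using Psi_sq_less[of "g x"]
  by (auto intro!: derivative_eq_intros assms simp: field_simps)

section \<open>The bivariate normal density as a function of the correlation\<close>

text \<open>With \<open>x = (t\<^sub>1 + t\<^sub>2) / 2\<close> and \<open>y = (t\<^sub>1 - t\<^sub>2) / 2\<close> this is the density at \<open>(t\<^sub>1, t\<^sub>2)\<close> of the
  bivariate normal distribution with correlation \<open>- s\<close>; exchanging \<open>x\<close> and \<open>y\<close> flips the sign of the
  correlation.\<close>

definition kern :: "real \<Rightarrow> real \<Rightarrow> real \<Rightarrow> real" where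
  "kern x y s = exp (- (x\<^sup>2 / (1 - s)) - y\<^sup>2 / (1 + s)) / (2 * pi * sqrt (1 - s\<^sup>2))"

definition JJ :: "real \<Rightarrow> real \<Rightarrow> real \<Rightarrow> real" where
  "JJ x y r = integral {0..r} (kern x y)"

lemma JJ_minus_left [simp]: "JJ (- x) y r = JJ x y r"
  and JJ_minus_right [simp]: "JJ x (- y) r = JJ x y r"
  by (simp_all add: JJ_def kern_def[abs_def])

lemma one_minus_sq_pos: "0 \<le> s \<Longrightarrow> s < 1 \<Longrightarrow> 0 < 1 - (s::real)\<^sup>2"
  using abs_square_less_1[of s] by simp

lemma kern_pos: "0 \<le> s \<Longrightarrow> s < 1 \<Longrightarrow> 0 < kern x y s"
  unfolding kern_def using one_minus_sq_pos[of s] by simp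

lemma continuous_on_kern:
  assumes "continuous_on S f" "continuous_on S g" "continuous_on S h"
    and "\<And>z. z \<in> S \<Longrightarrow> 0 \<le> h z \<and> h z < 1"
  shows "continuous_on S (\<lambda>z. kern (f z) (g z) (h z))"
proof -
  have "1 - h z \<noteq> 0" "1 + h z \<noteq> 0" "sqrt (1 - (h z)\<^sup>2) \<noteq> 0" if "z \<in> S" for z
    using assms(4)[OF that] one_minus_sq_pos[of "h z"] by auto
  then show ?thesis
    unfolding kern_def by (intro continuous_intros assms(1-3)) auto
qed

lemma kern_integrable:
  assumes "r < 1"
  shows "kern x y integrable_on {0..r}"
  by (intro integrable_continuous_interval continuous_on_kern)
    (use assms in \<open>auto intro!: continuous_intros\<close>)

lemma JJ_nonneg:
  assumes "r < 1"
  shows "0 \<le> JJ x y r"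
  unfolding JJ_def
  by (rule integral_nonneg[OF kern_integrable[OF assms]])
    (use assms kern_pos in \<open>auto intro!: less_imp_le\<close>)

section \<open>Derivatives of the integrated density\<close>

lemma kern_deriv_line:
  assumes "0 \<le> s" "s < 1"
  shows "((\<lambda>\<tau>. kern (p * \<tau> + a) (q * \<tau> + b) s) has_real_derivative
      kern (p * \<tau> + a) (q * \<tau> + b) s * (- 2 * p * (p * \<tau> + a) / (1 - s) - 2 * q * (q * \<tau> + b) / (1 + s)))
      (at \<tau> within S)"
proof -
  define A B C where "A = 1 / (1 - s)" and "B = 1 / (1 + s)" and "C = 1 / (2 * pi * sqrt (1 - s\<^sup>2))"
  have "kern x y s = exp (- (x\<^sup>2 * A) - y\<^sup>2 * B) * C" for x y
    by (simp add: kern_def A_def B_def C_def)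
  moreover have "- 2 * p * (p * \<tau> + a) / (1 - s) - 2 * q * (q * \<tau> + b) / (1 + s)
      = - 2 * p * (p * \<tau> + a) * A - 2 * q * (q * \<tau> + b) * B"
    by (simp add: A_def B_def)
  moreover have "((\<lambda>\<tau>. - ((p * \<tau> + a)\<^sup>2 * A) - (q * \<tau> + b)\<^sup>2 * B) has_real_derivative
      (- 2 * p * (p * \<tau> + a) * A - 2 * q * (q * \<tau> + b) * B)) (at \<tau> within S)"
    by (auto intro!: derivative_eq_intros)
  from DERIV_cmult_right[OF DERIV_chain2[OF DERIV_exp this], of C]
  have "((\<lambda>\<tau>. exp (- ((p * \<tau> + a)\<^sup>2 * A) - (q * \<tau> + b)\<^sup>2 * B) * C) has_real_derivative
      exp (- ((p * \<tau> + a)\<^sup>2 * A) - (q * \<tau> + b)\<^sup>2 * B) * C *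
      (- 2 * p * (p * \<tau> + a) * A - 2 * q * (q * \<tau> + b) * B)) (at \<tau> within S)"
    by (simp only: mult_ac)
  ultimately show ?thesis
    by (simp only:)
qed

text \<open>Lines in the plane of \<open>x\<close> and \<open>y\<close> cover every direction needed
  later: both axes, and the diagonals along which a single threshold moves. Since
  \<open>r < 1\<close>, the integration stays away from the singularity of the density at
  \<open>s = 1\<close>.\<close>

lemma JJ_deriv_line:
  assumes "r < 1"
  shows "((\<lambda>\<tau>. JJ (p * \<tau> + a) (q * \<tau> + b) r) has_real_derivative
      integral {0..r} (\<lambda>s. kern (p * \<tau> + a) (q * \<tau> + b) s *
        (- 2 * p * (p * \<tau> + a) / (1 - s) - 2 * q * (q * \<tau> + b) / (1 + s)))) (at \<tau>)"
  unfolding JJ_def cbox_interval[symmetric]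
proof (rule leibniz_rule_field_derivative)
  fix \<tau> s :: real
  assume "s \<in> cbox 0 r"
  then show "((\<lambda>\<tau>. kern (p * \<tau> + a) (q * \<tau> + b) s) has_real_derivative
      kern (p * \<tau> + a) (q * \<tau> + b) s * (- 2 * p * (p * \<tau> + a) / (1 - s) - 2 * q * (q * \<tau> + b) / (1 + s)))
      (at \<tau>)"
    using assms by (intro kern_deriv_line) auto
next
  show "kern (p * \<tau> + a) (q * \<tau> + b) integrable_on cbox 0 r" for \<tau>
    using kern_integrable[OF assms] by simp
next
  show "continuous_on (UNIV \<times> cbox 0 r) (\<lambda>(\<tau>, s). kern (p * \<tau> + a) (q * \<tau> + b) s *
        (- 2 * p * (p * \<tau> + a) / (1 - s) - 2 * q * (q * \<tau> + b) / (1 + s)))"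
    unfolding split_beta using assms
    by (intro continuous_intros continuous_on_kern) auto
qed auto

lemma JJ_deriv_corr:
  assumes "0 < r" "r < 1"
  shows "((\<lambda>r. JJ x y r) has_real_derivative kern x y r) (at r)"
proof -
  have "((\<lambda>r. JJ x y r) has_real_derivative kern x y r) (at r within {0..(r + 1) / 2})"
    unfolding JJ_def
    by (rule integral_has_real_derivative)
      (use assms in \<open>auto intro!: continuous_on_kern continuous_intros\<close>)
  then show ?thesis
    using at_within_Icc_at[of 0 r "(r + 1) / 2"] assms by simp
qed

text \<open>These roots are the factors \<open>g\<close> for which
  \<open>phi v * phi (v * g)\<close> has the exponent of \<open>kern\<close> on an axis:
  \<open>v^2 + (v * g)^2\<close> is \<open>2 * v^2 / (1 + s)\<close> for the first and
  \<open>2 * v^2 / (1 - s)\<close> for the second.\<close>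

lemma sqrt_quot_deriv:
  assumes "0 \<le> s" "s < 1"
  shows "((\<lambda>s. sqrt ((1 - s) / (1 + s))) has_real_derivative
      - 1 / ((1 + s) * sqrt (1 - s\<^sup>2))) (at s within S)"
    and "((\<lambda>s. sqrt ((1 + s) / (1 - s))) has_real_derivative
      1 / ((1 - s) * sqrt (1 - s\<^sup>2))) (at s within S)"
proof -
  define u v where "u = sqrt (1 - s)" and "v = sqrt (1 + s)"
  have uv: "0 < u" "0 < v" "u\<^sup>2 = 1 - s" "v\<^sup>2 = 1 + s"
    using assms by (auto simp: u_def v_def)
  have w: "sqrt (1 - s\<^sup>2) = u * v"
    unfolding u_def v_def real_sqrt_mult[symmetric] by (simp add: power2_eq_square algebra_simps)
  have "((\<lambda>s. (1 - s) / (1 + s)) has_real_derivative - 2 / (v\<^sup>2)\<^sup>2) (at s within S)"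
    unfolding uv using assms
    by (auto intro!: derivative_eq_intros simp: field_simps power2_eq_square)
  moreover have "0 < (1 - s) / (1 + s)"
    using assms by simp
  ultimately have "((\<lambda>s. sqrt ((1 - s) / (1 + s))) has_real_derivative
      (inverse (sqrt ((1 - s) / (1 + s))) / 2) * (- 2 / (v\<^sup>2)\<^sup>2)) (at s within S)"
    by (rule DERIV_chain2[OF DERIV_real_sqrt, rotated])
  moreover have "(inverse (sqrt ((1 - s) / (1 + s))) / 2) * (- 2 / (v\<^sup>2)\<^sup>2) = - 1 / ((1 + s) * sqrt (1 - s\<^sup>2))"
    unfolding w real_sqrt_divide u_def[symmetric] v_def[symmetric] uv(4)[symmetric]
    using uv(1,2) by (simp add: field_simps power2_eq_square)
  ultimately show "((\<lambda>s. sqrt ((1 - s) / (1 + s))) has_real_derivative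
      - 1 / ((1 + s) * sqrt (1 - s\<^sup>2))) (at s within S)"
    by simp
  have "((\<lambda>s. (1 + s) / (1 - s)) has_real_derivative 2 / (u\<^sup>2)\<^sup>2) (at s within S)"
    unfolding uv using assms
    by (auto intro!: derivative_eq_intros simp: field_simps power2_eq_square)
  moreover have "0 < (1 + s) / (1 - s)"
    using assms by simp
  ultimately have "((\<lambda>s. sqrt ((1 + s) / (1 - s))) has_real_derivative
      (inverse (sqrt ((1 + s) / (1 - s))) / 2) * (2 / (u\<^sup>2)\<^sup>2)) (at s within S)"
    by (rule DERIV_chain2[OF DERIV_real_sqrt, rotated])
  moreover have "(inverse (sqrt ((1 + s) / (1 - s))) / 2) * (2 / (u\<^sup>2)\<^sup>2) = 1 / ((1 - s) * sqrt (1 - s\<^sup>2))"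
    unfolding w real_sqrt_divide u_def[symmetric] v_def[symmetric] uv(3)[symmetric]
    using uv(1,2) by (simp add: field_simps power2_eq_square)
  ultimately show "((\<lambda>s. sqrt ((1 + s) / (1 - s))) has_real_derivative
      1 / ((1 - s) * sqrt (1 - s\<^sup>2))) (at s within S)"
    by simp
qed

lemma integral_real_FTC:
  fixes F f :: "real \<Rightarrow> real"
  assumes "a \<le> b"
    and "\<And>s. a \<le> s \<Longrightarrow> s \<le> b \<Longrightarrow> (F has_real_derivative f s) (at s within {a..b})"
  shows "integral {a..b} f = F b - F a"
  by (intro integral_unique fundamental_theorem_of_calculus)
    (use assms in \<open>auto simp: has_real_derivative_iff_has_vector_derivative[symmetric]\<close>)

text \<open>On the axis the density contains the factor \<open>phi y * phi (y * g)\<close>, with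
  \<open>g\<close> a function of \<open>s\<close> alone. This makes its \<open>y\<close>-derivative
  an exact \<open>s\<close>-derivative, so the integral collapses to the end values of
  \<open>F\<close>.\<close>

lemma JJ_deriv_right:
  assumes "0 \<le> r" "r < 1"
  shows "((\<lambda>y. JJ 0 y r) has_real_derivative
      - 2 * phi y * (Psi y - Psi (y * sqrt ((1 - r) / (1 + r))))) (at y)"
proof -
  define F where "F s = 2 * phi y * Psi (y * sqrt ((1 - s) / (1 + s)))" for s
  have "(F has_real_derivative kern 0 y s * (- 2 * y / (1 + s))) (at s within {0..r})"
    if "0 \<le> s" "s \<le> r" for s
  proof -
    have s: "0 \<le> s" "s < 1" using that assms by auto
    let ?g = "sqrt ((1 - s) / (1 + s))"
    have F: "(F has_real_derivative 2 * phi y * (phi (y * ?g) * (y * (- 1 / ((1 + s) * sqrt (1 - s\<^sup>2))))))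
        (at s within {0..r})"
      unfolding F_def
      by (rule derivative_eq_intros sqrt_quot_deriv(1)[OF s] refl | simp)+
    have "(y\<^sup>2 + (y * ?g)\<^sup>2) / 2 = y\<^sup>2 / (1 + s)"
      using s by (simp add: power_mult_distrib field_simps)
    then have "phi y * phi (y * ?g) = exp (- (y\<^sup>2 / (1 + s))) / (2 * pi)"
      unfolding phi_mult by (simp only:)
    moreover have "2 * phi y * (phi (y * ?g) * (y * (- 1 / ((1 + s) * sqrt (1 - s\<^sup>2)))))
        = (phi y * phi (y * ?g)) * (- 2 * y / (1 + s)) / sqrt (1 - s\<^sup>2)"
      by simp
    ultimately have "2 * phi y * (phi (y * ?g) * (y * (- 1 / ((1 + s) * sqrt (1 - s\<^sup>2)))))
        = kern 0 y s * (- 2 * y / (1 + s))"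
      by (simp only: kern_def) simp
    with F show ?thesis by (simp only:)
  qed
  then have "integral {0..r} (\<lambda>s. kern 0 y s * (- 2 * y / (1 + s))) = F r - F 0"
    by (rule integral_real_FTC[OF assms(1)])
  then have "integral {0..r} (\<lambda>s. kern (0 * y + 0) (1 * y + 0) s *
      (- 2 * 0 * (0 * y + 0) / (1 - s) - 2 * 1 * (1 * y + 0) / (1 + s))) = F r - F 0"
    by simp
  from JJ_deriv_line[OF assms(2), where p = 0 and a = 0 and q = 1 and b = 0 and \<tau> = y, unfolded this]
  show ?thesis
    by (simp add: F_def right_diff_distrib)
qed

lemma JJ_deriv_left:
  assumes "0 \<le> r" "r < 1"
  shows "((\<lambda>x. JJ x 0 r) has_real_derivative
      - 2 * phi x * (Psi (x * sqrt ((1 + r) / (1 - r))) - Psi x)) (at x)"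
proof -
  define F where "F s = - 2 * phi x * Psi (x * sqrt ((1 + s) / (1 - s)))" for s
  have "(F has_real_derivative kern x 0 s * (- 2 * x / (1 - s))) (at s within {0..r})"
    if "0 \<le> s" "s \<le> r" for s
  proof -
    have s: "0 \<le> s" "s < 1" using that assms by auto
    let ?g = "sqrt ((1 + s) / (1 - s))"
    have F: "(F has_real_derivative - 2 * phi x * (phi (x * ?g) * (x * (1 / ((1 - s) * sqrt (1 - s\<^sup>2))))))
        (at s within {0..r})"
      unfolding F_def
      by (rule derivative_eq_intros sqrt_quot_deriv(2)[OF s] refl | simp)+
    have "(x\<^sup>2 + (x * ?g)\<^sup>2) / 2 = x\<^sup>2 / (1 - s)"
      using s by (simp add: power_mult_distrib field_simps)
    then have "phi x * phi (x * ?g) = exp (- (x\<^sup>2 / (1 - s))) / (2 * pi)"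
      unfolding phi_mult by (simp only:)
    moreover have "- 2 * phi x * (phi (x * ?g) * (x * (1 / ((1 - s) * sqrt (1 - s\<^sup>2)))))
        = (phi x * phi (x * ?g)) * (- 2 * x / (1 - s)) / sqrt (1 - s\<^sup>2)"
      by simp
    ultimately have "- 2 * phi x * (phi (x * ?g) * (x * (1 / ((1 - s) * sqrt (1 - s\<^sup>2)))))
        = kern x 0 s * (- 2 * x / (1 - s))"
      by (simp only: kern_def) simp
    with F show ?thesis by (simp only:)
  qed
  then have "integral {0..r} (\<lambda>s. kern x 0 s * (- 2 * x / (1 - s))) = F r - F 0"
    by (rule integral_real_FTC[OF assms(1)])
  then have "integral {0..r} (\<lambda>s. kern (1 * x + 0) (0 * x + 0) s *
      (- 2 * 1 * (1 * x + 0) / (1 - s) - 2 * 0 * (0 * x + 0) / (1 + s))) = F r - F 0"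
    by simp
  from JJ_deriv_line[OF assms(2), where p = 1 and a = 0 and q = 0 and b = 0 and \<tau> = x, unfolded this]
  show ?thesis
    by (simp add: F_def right_diff_distrib)
qed

text \<open>Conditioning: the marginal density at \<open>u\<close> times the density at
  \<open>t\<close> of a normal variable with mean \<open>c * s * u\<close> and variance
  \<open>1 - s^2\<close>. The sign \<open>c\<close> selects correlation \<open>s\<close> or
  \<open>- s\<close>.\<close>

lemma kern_eq_phi_phi:
  assumes "0 \<le> s" "s < 1" "c\<^sup>2 = 1"
  shows "kern ((u - c * t) / 2) ((u + c * t) / 2) s
    = phi u * phi ((t - c * s * u) / sqrt (1 - s\<^sup>2)) / sqrt (1 - s\<^sup>2)"
proof -
  have p: "0 < 1 - s\<^sup>2" using one_minus_sq_pos assms by simp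
  have fac: "1 - s\<^sup>2 = (1 - s) * (1 + s)"
    by (simp add: power2_eq_square algebra_simps)
  have "((u - c * t) / 2)\<^sup>2 / (1 - s) + ((u + c * t) / 2)\<^sup>2 / (1 + s)
      = (((u - c * t) / 2)\<^sup>2 * (1 + s) + ((u + c * t) / 2)\<^sup>2 * (1 - s)) / (1 - s\<^sup>2)"
    unfolding fac using assms by (simp add: add_frac_eq)
  \<comment> \<open>The remainder carries the factor \<open>c^2 - 1\<close>, so one identity serves
    both signs.\<close>
  also have "((u - c * t) / 2)\<^sup>2 * (1 + s) + ((u + c * t) / 2)\<^sup>2 * (1 - s)
      = (u\<^sup>2 * (1 - s\<^sup>2) + (t - c * s * u)\<^sup>2) / 2
        + (c\<^sup>2 - 1) * (t\<^sup>2 / 2 - s\<^sup>2 * u\<^sup>2 / 2)"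
    by (simp add: field_simps power2_eq_square)
  also have "\<dots> / (1 - s\<^sup>2) = (u\<^sup>2 + ((t - c * s * u) / sqrt (1 - s\<^sup>2))\<^sup>2) / 2"
    using p assms(3) by (simp add: power_divide field_simps)
  finally show ?thesis
    unfolding phi_mult kern_def by (simp add: field_simps)
qed

text \<open>\<open>phi u\<close> times the difference between the conditional and the unconditional
  distribution function of the other variable. It is derived from the density alone, by a primitive
  in \<open>s\<close>, because the link with \<open>Phi2\<close> will rest on it.\<close>

lemma JJ_deriv_cdf:
  assumes "0 \<le> r" "r < 1" "c\<^sup>2 = 1"
  shows "((\<lambda>u. JJ ((u - c * t) / 2) ((u + c * t) / 2) r) has_real_derivative
      c * phi u * (Psi ((t - c * r * u) / sqrt (1 - r\<^sup>2)) - Psi t)) (at u)"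
proof -
  have cc: "c * c = 1" using assms(3) by (simp add: power2_eq_square)
  let ?k = "\<lambda>s. kern ((u - c * t) / 2) ((u + c * t) / 2) s"
  define F where "F s = c * phi u * Psi ((t - c * s * u) / sqrt (1 - s\<^sup>2))" for s
  have "(F has_real_derivative ?k s * (- (u - c * s * t) / (1 - s\<^sup>2))) (at s within {0..r})"
    if "0 \<le> s" "s \<le> r" for s
  proof -
    have s: "0 \<le> s" "s < 1" using that assms by auto
    have p: "0 < 1 - s\<^sup>2" using one_minus_sq_pos s by simp
    define q where "q = sqrt (1 - s\<^sup>2)"
    have q: "0 < q" "q\<^sup>2 = 1 - s\<^sup>2" using p by (auto simp: q_def)
    have "((\<lambda>s. sqrt (1 - s\<^sup>2)) has_real_derivative - s / q) (at s within {0..r})"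
      unfolding q_def using p by (auto intro!: derivative_eq_intros simp: field_simps)
    then have "((\<lambda>s. (t - c * s * u) / sqrt (1 - s\<^sup>2)) has_real_derivative
        ((- (c * u)) * q - (t - c * s * u) * (- s / q)) / (q * q)) (at s within {0..r})"
      unfolding q_def[symmetric] using q unfolding q_def
      by (intro DERIV_divide) (auto intro!: derivative_eq_intros)
    moreover have "((- (c * u)) * q - (t - c * s * u) * (- s / q)) / (q * q)
        = - c * (u - c * s * t) / (q\<^sup>2 * q)"
    proof -
      have "((- (c * u)) * q - (t - c * s * u) * (- s / q)) / (q * q)
          = (- (c * u) * q\<^sup>2 + (t - c * s * u) * s) / (q\<^sup>2 * q)"
        using q(1) by (simp add: field_simps power2_eq_square)
      also have "- (c * u) * q\<^sup>2 + (t - c * s * u) * s = - c * (u - c * s * t) + (1 - c * c) * s * t"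
        unfolding q(2) by (simp add: algebra_simps power2_eq_square)
      finally show ?thesis using cc by simp
    qed
    ultimately have "((\<lambda>s. (t - c * s * u) / sqrt (1 - s\<^sup>2)) has_real_derivative
        - c * (u - c * s * t) / (q\<^sup>2 * q)) (at s within {0..r})"
      by simp
    from DERIV_cmult[OF Psi_deriv[OF this], of "c * phi u"]
    have "(F has_real_derivative c * phi u * (phi ((t - c * s * u) / q) * (- c * (u - c * s * t) / (q\<^sup>2 * q))))
        (at s within {0..r})"
      unfolding F_def q_def .
    moreover have "c * phi u * (phi ((t - c * s * u) / q) * (- c * (u - c * s * t) / (q\<^sup>2 * q)))
        = (c * c) * (?k s * (- (u - c * s * t) / (1 - s\<^sup>2)))"
      unfolding kern_eq_phi_phi[OF s assms(3)] q(2)[symmetric] q_def[symmetric]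
      using q(1) by (simp add: field_simps)
    ultimately show ?thesis using cc by simp
  qed
  then have "integral {0..r} (\<lambda>s. ?k s * (- (u - c * s * t) / (1 - s\<^sup>2))) = F r - F 0"
    by (rule integral_real_FTC[OF assms(1)])
  moreover have "- 2 * (1 / 2) * ((u - c * t) / 2) / (1 - s)
      - 2 * (1 / 2) * ((u + c * t) / 2) / (1 + s) = - (u - c * s * t) / (1 - s\<^sup>2)"
    if "s \<in> {0..r}" for s
  proof -
    have fac: "1 - s\<^sup>2 = (1 - s) * (1 + s)"
      by (simp add: power2_eq_square algebra_simps)
    have "- 2 * (1 / 2) * a / (1 - s) - 2 * (1 / 2) * b / (1 + s)
        = (- a * (1 + s) - b * (1 - s)) / ((1 - s) * (1 + s))" for a b
      using that assms by (simp add: field_simps)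
    from this[of "(u - c * t) / 2" "(u + c * t) / 2"]
    have "- 2 * (1 / 2) * ((u - c * t) / 2) / (1 - s) - 2 * (1 / 2) * ((u + c * t) / 2) / (1 + s)
        = (- ((u - c * t) / 2) * (1 + s) - ((u + c * t) / 2) * (1 - s)) / ((1 - s) * (1 + s))" .
    also have "- ((u - c * t) / 2) * (1 + s) - ((u + c * t) / 2) * (1 - s) = - (u - c * s * t)"
      by (simp add: algebra_simps add_divide_distrib diff_divide_distrib)
    finally show ?thesis
      unfolding fac .
  qed
  ultimately have I: "integral {0..r} (\<lambda>s. ?k s *
      (- 2 * (1 / 2) * ((u - c * t) / 2) / (1 - s) - 2 * (1 / 2) * ((u + c * t) / 2) / (1 + s))) = F r - F 0"
    by (metis (mono_tags, lifting) integral_cong)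
  have lin: "1 / 2 * u + - (c * t) / 2 = (u - c * t) / 2" "1 / 2 * u + c * t / 2 = (u + c * t) / 2" for u
    by (simp_all add: diff_divide_distrib add_divide_distrib)
  from JJ_deriv_line[OF assms(2), where p = "1/2" and a = "- (c * t) / 2" and q = "1/2" and b = "c * t / 2" and \<tau> = u,
      unfolded lin I]
  show ?thesis
    by (simp add: F_def right_diff_distrib)
qed

section \<open>The bivariate normal distribution function\<close>

lemma phi_le_1: "phi x \<le> 1"
proof -
  have "1 \<le> sqrt (2 * pi)" using pi_gt3 by simp
  moreover have "exp (- (x\<^sup>2 / 2)) \<le> 1" by simp
  ultimately have "exp (- (x\<^sup>2 / 2)) / sqrt (2 * pi) \<le> 1 / 1"
    by (intro frac_le) auto
  then show ?thesis
    unfolding phi_eq by simp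
qed

lemma phi_tendsto_top: "(phi \<longlongrightarrow> 0) at_top"
proof -
  have "filterlim (\<lambda>x::real. (1 / 2) * x\<^sup>2) at_top at_top"
    by (rule filterlim_tendsto_pos_mult_at_top[OF tendsto_const _ filterlim_pow_at_top[OF _ filterlim_ident]]) auto
  then have "filterlim (\<lambda>x::real. x\<^sup>2 / 2) at_top at_top"
    by simp
  then have "((\<lambda>x::real. exp (- (x\<^sup>2 / 2))) \<longlongrightarrow> 0) at_top"
    using filterlim_compose[OF exp_at_bot filterlim_compose[OF filterlim_uminus_at_bot_at_top]] by blast
  then have "((\<lambda>x::real. exp (- (x\<^sup>2 / 2)) / sqrt (2 * pi)) \<longlongrightarrow> 0 / sqrt (2 * pi)) at_top"
    by (intro tendsto_divide tendsto_const) auto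
  then show ?thesis by (simp add: phi_eq[abs_def])
qed

lemma phi_tendsto_bot: "(phi \<longlongrightarrow> 0) at_bot"
  using phi_tendsto_top by (simp add: filterlim_at_bot_mirror)

text \<open>Crude, but uniform in \<open>t\<close>: it makes \<open>JJ\<close> vanish as
  \<open>u\<close> tends to infinity, even when \<open>t\<close> moves along with
  \<open>u\<close>.\<close>

lemma JJ_le_phi:
  assumes "0 \<le> r" "r < 1" "c\<^sup>2 = 1"
  shows "JJ ((u - c * t) / 2) ((u + c * t) / 2) r \<le> phi u * (r / sqrt (1 - r\<^sup>2))"
proof -
  have "JJ ((u - c * t) / 2) ((u + c * t) / 2) r \<le> integral {0..r} (\<lambda>s. phi u / sqrt (1 - r\<^sup>2))"
    unfolding JJ_def
  proof (rule integral_le[OF kern_integrable[OF assms(2)]])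
    fix s assume s: "s \<in> {0..r}"
    then have s': "0 \<le> s" "s < 1" using assms by auto
    have "sqrt (1 - r\<^sup>2) \<le> sqrt (1 - s\<^sup>2)" "0 < sqrt (1 - r\<^sup>2)"
      using s assms one_minus_sq_pos[of r] by (auto intro!: power_mono)
    moreover have "phi u * phi ((t - c * s * u) / sqrt (1 - s\<^sup>2)) \<le> phi u * 1"
      by (intro mult_left_mono phi_le_1) (simp add: less_imp_le phi_pos)
    ultimately show "kern ((u - c * t) / 2) ((u + c * t) / 2) s \<le> phi u / sqrt (1 - r\<^sup>2)"
      unfolding kern_eq_phi_phi[OF s' assms(3)]
      by (intro frac_le) auto
  qed auto
  also have "\<dots> = phi u * (r / sqrt (1 - r\<^sup>2))"
    using assms by simp
  finally show ?thesis .
qed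

text \<open>Plackett's identity, obtained without differentiating a probability in the correlation:
  as functions of \<open>u\<close>, both sides vanish at \<open>-\<infinity>\<close> and have the
  density \<open>g\<close>, the left by Fubini and the right by \<open>JJ_deriv_cdf\<close>.\<close>

lemma Phi2_eq_Phi_Phi_JJ:
  assumes r: "0 \<le> r" "r < 1" and c: "c\<^sup>2 = 1"
  shows "Phi2 (c * r) (ereal u) (ereal t)
    = Phi u * Phi t + c * JJ ((u - c * t) / 2) ((u + c * t) / 2) r"
proof -
  interpret M: prob_space std_normal by (rule prob_space_std_normal)
  define q where "q = sqrt (1 - r\<^sup>2)"
  have q: "0 < q" "sqrt (1 - (c * r)\<^sup>2) = q"
    using one_minus_sq_pos[OF r] c by (auto simp: q_def power_mult_distrib)
  define G where "G v = Phi v * Phi t + c * JJ ((v - c * t) / 2) ((v + c * t) / 2) r" for v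
  define g where "g v = phi v * Phi ((t - c * r * v) / q)" for v
  have cc: "c * c = 1" using c by (simp add: power2_eq_square)
  have G': "(G has_real_derivative g v) (at v)" for v
  proof -
    have "(G has_real_derivative phi v * Phi t
        + c * (c * phi v * (Psi ((t - c * r * v) / sqrt (1 - r\<^sup>2)) - Psi t))) (at v)"
      unfolding G_def using DERIV_cmult[OF JJ_deriv_cdf[OF r c, of t v], of c]
      by (intro DERIV_add DERIV_cmult_right Phi_deriv_at)
    also have "phi v * Phi t + c * (c * phi v * (Psi ((t - c * r * v) / sqrt (1 - r\<^sup>2)) - Psi t))
        = phi v * Phi t + (c * c) * phi v * (Psi ((t - c * r * v) / q) - Psi t)"
      by (simp add: q_def)
    also have "\<dots> = g v"
      unfolding cc g_def Psi_def by (simp add: algebra_simps)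
    finally show ?thesis .
  qed
  have g_nonneg: "0 \<le> g v" for v
    by (simp add: g_def Phi_nonneg)
  have isCont_g: "isCont g v" for v
  proof -
    have "isCont (\<lambda>v. (t - c * r * v) / q) v"
      using q by (intro continuous_intros) auto
    then have "isCont (\<lambda>v. Phi ((t - c * r * v) / q)) v"
      by (rule isCont_o2[OF _ DERIV_isCont[OF Phi_deriv_at]])
    then show ?thesis
      unfolding g_def by (intro continuous_mult isCont_phi)
  qed
  have G_bot: "(G \<longlongrightarrow> 0) at_bot"
  proof -
    have "((\<lambda>v. JJ ((v - c * t) / 2) ((v + c * t) / 2) r) \<longlongrightarrow> 0) at_bot"
    proof (rule tendsto_sandwich[where f = "\<lambda>_. 0" and h = "\<lambda>v. phi v * (r / sqrt (1 - r\<^sup>2))"])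
      show "((\<lambda>v. phi v * (r / sqrt (1 - r\<^sup>2))) \<longlongrightarrow> 0) at_bot"
        by (intro tendsto_mult_left_zero phi_tendsto_bot)
    qed (use JJ_nonneg[OF r(2)] JJ_le_phi[OF r c] in auto)
    then show ?thesis
      unfolding G_def
      by (auto intro!: tendsto_eq_intros Phi_tendsto_bot)
  qed
  \<comment> \<open>The fundamental theorem on an unbounded interval takes its end limits in
    \<open>ereal\<close>; nonnegativity of \<open>g\<close> supplies integrability.\<close>
  have "((G \<circ> real_of_ereal) \<longlongrightarrow> 0) (at_right (-\<infinity>))"
    using G_bot by (simp add: ereal_tendsto_simps)
  moreover have "((G \<circ> real_of_ereal) \<longlongrightarrow> G u) (at_left (ereal u))"
    using DERIV_isCont[OF G', of u]
    by (simp only: ereal_tendsto_simps isCont_def filterlim_at_split)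
  ultimately have int: "set_integrable lborel (einterval (-\<infinity>) (ereal u)) g"
    and val: "(LBINT v=-\<infinity>..ereal u. g v) = G u - 0"
    using interval_integral_FTC_nonneg[where a = "-\<infinity>" and b = "ereal u" and F = G and f = g]
      G' isCont_g g_nonneg by auto
  have ein: "einterval (-\<infinity>) (ereal u) = {..<u}"
    by (auto simp: einterval_def)
  define A where "A = {z::real \<times> real. fst z \<le> u \<and> c * r * fst z + q * snd z \<le> t}"
  have A: "A \<in> sets (std_normal \<Otimes>\<^sub>M std_normal)"
  proof -
    have "A \<in> sets (borel \<Otimes>\<^sub>M borel)"
      unfolding A_def borel_prod
      by (intro borel_closed closed_Collect_conj closed_Collect_le continuous_intros)
    also have "sets (borel \<Otimes>\<^sub>M borel) = sets (std_normal \<Otimes>\<^sub>M std_normal)"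
      by (intro sets_pair_measure_cong) auto
    finally show ?thesis .
  qed
  \<comment> \<open>For a fixed first coordinate \<open>v\<close> the event is a half-line in the
    second one, and empty beyond \<open>u\<close>.\<close>
  have slice: "emeasure std_normal (Pair v -` A) = ennreal (indicator {..u} v * Phi ((t - c * r * v) / q))" for v
  proof (cases "v \<le> u")
    case True
    have "Pair v -` A = {..(t - c * r * v) / q}"
      using True q by (auto simp: A_def field_simps)
    then show ?thesis
      using True by (simp add: M.emeasure_eq_measure Phi_def)
  next
    case False
    then have "Pair v -` A = {}" by (auto simp: A_def)
    then show ?thesis using False by simp
  qed
  have meas: "(\<lambda>v. indicator {..u} v * Phi ((t - c * r * v) / q)) \<in> borel_measurable borel"
  proof -
    have "Phi \<in> borel_measurable borel"
      by (intro borel_measurable_continuous_onI)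
        (use Phi_deriv_at DERIV_isCont in \<open>blast intro: continuous_at_imp_continuous_on\<close>)
    then show ?thesis by measurable
  qed
  have "emeasure (std_normal \<Otimes>\<^sub>M std_normal) A
      = (\<integral>\<^sup>+v. ennreal (indicator {..u} v * Phi ((t - c * r * v) / q)) \<partial>std_normal)"
    by (subst M.emeasure_pair_measure_alt[OF A]) (simp add: slice)
  also have "\<dots> = (\<integral>\<^sup>+v. ennreal (phi v) * ennreal (indicator {..u} v * Phi ((t - c * r * v) / q)) \<partial>lborel)"
    unfolding std_normal_def using meas by (subst nn_integral_density) auto
  also have "\<dots> = (\<integral>\<^sup>+v. ennreal (indicator {..<u} v * g v) \<partial>lborel)"
    by (intro nn_integral_cong_AE eventually_mono[OF AE_lborel_singleton[of u]])
      (auto simp: indicator_def g_def ennreal_mult'[symmetric])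
  also have "\<dots> = ennreal (\<integral>v. indicator {..<u} v * g v \<partial>lborel)"
    using int unfolding set_integrable_def ein
    by (intro nn_integral_eq_integral) (auto intro!: AE_I2 mult_nonneg_nonneg g_nonneg)
  also have "(\<integral>v. indicator {..<u} v * g v \<partial>lborel) = G u"
    using val by (simp add: interval_lebesgue_integral_def ein set_lebesgue_integral_def)
  finally have "emeasure (std_normal \<Otimes>\<^sub>M std_normal) A = ennreal (G u)" .
  moreover have "0 \<le> G u"
  proof -
    have "0 \<le> (\<integral>v. indicator {..<u} v * g v \<partial>lborel)"
      by (intro integral_nonneg_AE AE_I2 mult_nonneg_nonneg g_nonneg) auto
    then show ?thesis
      using val by (simp add: interval_lebesgue_integral_def ein set_lebesgue_integral_def)
  qed
  ultimately have "measure (std_normal \<Otimes>\<^sub>M std_normal) A = G u"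
    by (simp add: measure_def)
  then show ?thesis
    unfolding Phi2_def q(2) A_def G_def by simp
qed

section \<open>Reduction to equal thresholds\<close>

text \<open>The derivative is a positive multiple of \<open>(1 - r) * Psi v - Psi (v * w)\<close>,
  with \<open>w\<close> the scale from \<open>JJ_deriv_right\<close>. Concavity gives
  \<open>w * Psi v <= Psi (v * w)\<close>, and \<open>1 - r <= w\<close>.\<close>

lemma sd_sq_minus_JJ_antimono:
  assumes r: "0 \<le> r" "r < 1" and "0 \<le> y" "y \<le> z"
  shows "r * (sd z)\<^sup>2 - JJ 0 z r \<le> r * (sd y)\<^sup>2 - JJ 0 y r"
proof -
  let ?g = "\<lambda>y. r * (1 / 4 - (Psi y)\<^sup>2) - JJ 0 y r"
  define w where "w = sqrt ((1 - r) / (1 + r))"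
  have "(1 - r)\<^sup>2 * (1 + r) \<le> (1 - r) * 1"
    using r mult_left_mono[of "(1 - r) * (1 + r)" 1 "1 - r"]
    by (simp add: power2_eq_square algebra_simps)
  then have "(1 - r)\<^sup>2 \<le> (1 - r) / (1 + r)"
    using r by (simp add: le_divide_eq)
  then have w: "1 - r \<le> w"
    unfolding w_def by (rule real_le_rsqrt)
  have w': "0 \<le> w" "w \<le> 1"
    using r by (auto simp: w_def)
  have "?g z \<le> ?g y"
  proof (rule DERIV_nonpos_imp_nonincreasing[OF \<open>y \<le> z\<close>])
    fix v assume "y \<le> v" "v \<le> z"
    then have v: "0 \<le> v" using \<open>0 \<le> y\<close> by simp
    have "(?g has_real_derivative 2 * phi v * ((1 - r) * Psi v - Psi (v * w))) (at v)"
      unfolding w_def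
      by (rule derivative_eq_intros JJ_deriv_right[OF r] refl | simp)+ (simp add: algebra_simps)
    moreover have "(1 - r) * Psi v \<le> Psi (v * w)"
      using mult_right_mono[OF w Psi_nonneg[OF v]] Psi_scale_le[OF v w'] by (simp add: mult.commute)
    then have "2 * phi v * ((1 - r) * Psi v - Psi (v * w)) \<le> 0"
      using phi_pos[of v] by (intro mult_nonneg_nonpos) auto
    ultimately show "\<exists>d. (?g has_real_derivative d) (at v) \<and> d \<le> 0" by blast
  qed
  then show ?thesis by (simp add: sd_sq)
qed

text \<open>Gebelein's inequality for equal thresholds: the deficit decreases in \<open>y\<close>
  and tends to 0. The point \<open>(0, y)\<close> stands for thresholds \<open>y\<close>,
  \<open>- y\<close> at correlation \<open>- s\<close>, equivalently for \<open>y\<close>,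
  \<open>y\<close> at correlation \<open>s\<close>.\<close>

lemma JJ_right_le:
  assumes r: "0 \<le> r" "r < 1"
  shows "JJ 0 y r \<le> r * (sd y)\<^sup>2"
proof -
  have *: "JJ 0 y r \<le> r * (sd y)\<^sup>2" if y: "0 \<le> y" for y
  proof -
    have "((\<lambda>z. JJ 0 z r) \<longlongrightarrow> 0) at_top"
    proof (rule tendsto_sandwich[where f = "\<lambda>_. 0" and h = "\<lambda>v. phi v * (r / sqrt (1 - r\<^sup>2))"])
      show "((\<lambda>v. phi v * (r / sqrt (1 - r\<^sup>2))) \<longlongrightarrow> 0) at_top"
        by (intro tendsto_mult_left_zero phi_tendsto_top)
      show "\<forall>\<^sub>F v in at_top. JJ 0 v r \<le> phi v * (r / sqrt (1 - r\<^sup>2))"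
        using JJ_le_phi[OF r, where c = 1 and u = v and t = v for v] by simp
    qed (use JJ_nonneg[OF r(2)] in auto)
    then have "((\<lambda>z. r * (1 / 4 - (Psi z)\<^sup>2) - JJ 0 z r) \<longlongrightarrow> r * (1 / 4 - (1 / 2)\<^sup>2) - 0) at_top"
      by (intro tendsto_intros Psi_tendsto_top)
    moreover have "r * (1 / 4 - (1 / 2)\<^sup>2) - 0 = 0"
      by (simp add: power2_eq_square)
    ultimately have "((\<lambda>z. r * (sd z)\<^sup>2 - JJ 0 z r) \<longlongrightarrow> 0) at_top"
      by (simp only: sd_sq)
    then have "0 \<le> r * (sd y)\<^sup>2 - JJ 0 y r"
      by (rule tendsto_upperbound)
        (auto intro!: eventually_mono[OF eventually_ge_at_top[of y]] sd_sq_minus_JJ_antimono[OF r y])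
    then show ?thesis by simp
  qed
  show ?thesis
    using *[of y] *[of "- y"] by (cases "0 \<le> y") auto
qed

text \<open>Sheppard's orthant formula: at zero thresholds the density is
  \<open>1 / (2 * pi * sqrt (1 - s^2))\<close>.\<close>

lemma JJ_00:
  assumes "0 \<le> r" "r < 1"
  shows "JJ 0 0 r = arcsin r / (2 * pi)"
proof -
  have "integral {0..r} (kern 0 0) = arcsin r / (2 * pi) - arcsin 0 / (2 * pi)"
  proof (rule integral_real_FTC[OF assms(1)])
    fix s assume s: "0 \<le> s" "s \<le> r"
    then have "(arcsin has_real_derivative inverse (sqrt (1 - s\<^sup>2))) (at s)"
      using assms by (intro DERIV_arcsin) auto
    from DERIV_cdivide[OF DERIV_subset[OF this], of "{0..r}" "2 * pi"]
    show "((\<lambda>s. arcsin s / (2 * pi)) has_real_derivative kern 0 0 s) (at s within {0..r})"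
      by (simp add: kern_def field_simps)
  qed
  then show ?thesis by (simp add: JJ_def)
qed

text \<open>Holds already under the integral: after multiplication by \<open>exp (v^2 / 2)\<close>
  the exponent is \<open>- v^2\<close> times \<open>1 / (1 + s) - 1 / 2\<close>, which is
  nonnegative.\<close>

lemma JJ_exp_antimono:
  assumes r: "0 \<le> r" "r < 1" and yz: "\<bar>y\<bar> \<le> \<bar>z\<bar>"
  shows "JJ 0 z r * exp (z\<^sup>2 / 2) \<le> JJ 0 y r * exp (y\<^sup>2 / 2)"
proof -
  have "integral {0..r} (\<lambda>s. kern 0 z s * exp (z\<^sup>2 / 2)) \<le> integral {0..r} (\<lambda>s. kern 0 y s * exp (y\<^sup>2 / 2))"
  proof (rule integral_le)
    fix s assume "s \<in> {0..r}"
    then have s: "0 \<le> s" "s < 1" using r by auto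
    have e: "kern 0 v s * exp (v\<^sup>2 / 2) = exp (- (v\<^sup>2 * (1 / (1 + s) - 1 / 2))) / (2 * pi * sqrt (1 - s\<^sup>2))" for v
    proof -
      have "- (v\<^sup>2 / (1 + s)) + v\<^sup>2 / 2 = - (v\<^sup>2 * (1 / (1 + s) - 1 / 2))"
        by (simp add: algebra_simps)
      then show ?thesis
        by (simp add: kern_def exp_add[symmetric])
    qed
    have "1 / 2 \<le> 1 / (1 + s)" using s by (simp add: field_simps)
    moreover have "y\<^sup>2 \<le> z\<^sup>2" using yz by (simp add: abs_le_square_iff)
    ultimately have "y\<^sup>2 * (1 / (1 + s) - 1 / 2) \<le> z\<^sup>2 * (1 / (1 + s) - 1 / 2)"
      by (intro mult_right_mono) auto
    then show "kern 0 z s * exp (z\<^sup>2 / 2) \<le> kern 0 y s * exp (y\<^sup>2 / 2)"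
      unfolding e using one_minus_sq_pos[OF s] by (intro divide_right_mono) auto
  qed (intro integrable_on_mult_left kern_integrable r)+
  then show ?thesis
    by (simp add: JJ_def)
qed

text \<open>Letting the correlation tend to 1 turns the previous lemma into a statement about \<open>sd\<close>, since
  \<open>(sd y)\<^sup>2\<close> is the limit of \<open>JJ 0 y r\<close>.\<close>

lemma sd_sq_exp_antimono:
  assumes yz: "\<bar>y\<bar> \<le> \<bar>z\<bar>"
  shows "(sd z)\<^sup>2 * exp (z\<^sup>2 / 2) \<le> (sd y)\<^sup>2 * exp (y\<^sup>2 / 2)"
proof -
  \<comment> \<open>The error term is the deficit \<open>r * (sd y)^2 - JJ 0 y r\<close> at
    \<open>y = 0\<close>, where it is largest. It vanishes at \<open>r = 1\<close>, so nothing is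
    lost in the limit.\<close>
  have ineq: "r * (sd z)\<^sup>2 * exp (z\<^sup>2 / 2)
      \<le> r * (sd y)\<^sup>2 * exp (y\<^sup>2 / 2) + (r / 4 - arcsin r / (2 * pi)) * exp (z\<^sup>2 / 2)"
    if r: "0 \<le> r" "r < 1" for r
  proof -
    have "r * (sd \<bar>z\<bar>)\<^sup>2 - JJ 0 \<bar>z\<bar> r \<le> r * (sd 0)\<^sup>2 - JJ 0 0 r"
      by (rule sd_sq_minus_JJ_antimono[OF r]) auto
    then have "r * (sd z)\<^sup>2 \<le> JJ 0 z r + (r / 4 - arcsin r / (2 * pi))"
      by (cases "0 \<le> z") (auto simp: JJ_00[OF r] sd_sq[of 0])
    then have "r * (sd z)\<^sup>2 * exp (z\<^sup>2 / 2)
        \<le> JJ 0 z r * exp (z\<^sup>2 / 2) + (r / 4 - arcsin r / (2 * pi)) * exp (z\<^sup>2 / 2)"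
      unfolding distrib_right[symmetric] by (intro mult_right_mono) auto
    also have "JJ 0 z r * exp (z\<^sup>2 / 2) \<le> JJ 0 y r * exp (y\<^sup>2 / 2)"
      by (rule JJ_exp_antimono[OF r yz])
    also have "JJ 0 y r * exp (y\<^sup>2 / 2) \<le> r * (sd y)\<^sup>2 * exp (y\<^sup>2 / 2)"
      by (intro mult_right_mono JJ_right_le[OF r]) auto
    finally show ?thesis by simp
  qed
  have cont: "((\<lambda>r. arcsin r) \<longlongrightarrow> arcsin 1) (at 1 within {0..1})"
    using continuous_on_arcsin'[unfolded continuous_on_def, rule_format, of 1]
    by (rule tendsto_within_subset) auto
  have nontriv: "at (1::real) within {0..<1} \<noteq> bot"
    by (simp add: at_within_eq_bot_iff)
  have cont: "(arcsin \<longlongrightarrow> arcsin 1) (at 1 within {0..<1})"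
    using tendsto_within_subset[OF cont] by (simp add: subset_eq)
  have "1 * (sd z)\<^sup>2 * exp (z\<^sup>2 / 2)
      \<le> 1 * (sd y)\<^sup>2 * exp (y\<^sup>2 / 2) + (1 / 4 - arcsin 1 / (2 * pi)) * exp (z\<^sup>2 / 2)"
  proof (rule tendsto_le[OF nontriv])
    show "((\<lambda>r. r * (sd z)\<^sup>2 * exp (z\<^sup>2 / 2)) \<longlongrightarrow> 1 * (sd z)\<^sup>2 * exp (z\<^sup>2 / 2)) (at 1 within {0..<1})"
      by (intro tendsto_intros)
    show "((\<lambda>r. r * (sd y)\<^sup>2 * exp (y\<^sup>2 / 2) + (r / 4 - arcsin r / (2 * pi)) * exp (z\<^sup>2 / 2)) \<longlongrightarrow>
        1 * (sd y)\<^sup>2 * exp (y\<^sup>2 / 2) + (1 / 4 - arcsin 1 / (2 * pi)) * exp (z\<^sup>2 / 2)) (at 1 within {0..<1})"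
      by (intro tendsto_intros cont) auto
    show "\<forall>\<^sub>F r in at 1 within {0..<1}. r * (sd z)\<^sup>2 * exp (z\<^sup>2 / 2)
        \<le> r * (sd y)\<^sup>2 * exp (y\<^sup>2 / 2) + (r / 4 - arcsin r / (2 * pi)) * exp (z\<^sup>2 / 2)"
      unfolding eventually_at_filter using ineq by (intro always_eventually) auto
  qed
  then show ?thesis by simp
qed

lemma sd_exp_antimono:
  assumes "\<bar>y\<bar> \<le> \<bar>z\<bar>"
  shows "sd z * exp (z\<^sup>2 / 4) \<le> sd y * exp (y\<^sup>2 / 4)"
proof (rule power2_le_imp_le)
  have "(exp (v\<^sup>2 / 4))\<^sup>2 = exp (v\<^sup>2 / 2)" for v :: real
    by (simp add: power2_eq_square exp_add[symmetric])
  then show "(sd z * exp (z\<^sup>2 / 4))\<^sup>2 \<le> (sd y * exp (y\<^sup>2 / 4))\<^sup>2"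
    using sd_sq_exp_antimono[OF assms] by (simp add: power_mult_distrib)
  show "0 \<le> sd y * exp (y\<^sup>2 / 4)"
    using sd_pos[of y] by simp
qed

text \<open>The quotient is the derivative of the log-odds \<open>ln (Phi / (1 - Phi))\<close>. Up
  to a constant it is the reciprocal of \<open>(sd v)^2 * exp (v^2 / 2)\<close>, so the monotonicity
  just proved is reversed.\<close>

lemma phi_div_sd_sq_mono:
  assumes "\<bar>y\<bar> \<le> \<bar>z\<bar>"
  shows "phi y / (sd y)\<^sup>2 \<le> phi z / (sd z)\<^sup>2"
proof -
  have "phi v / (sd v)\<^sup>2 = 1 / (sqrt (2 * pi) * ((sd v)\<^sup>2 * exp (v\<^sup>2 / 2)))" for v
    by (simp add: phi_eq exp_minus field_simps)
  then show ?thesis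
    using sd_sq_exp_antimono[OF assms] sd_pos[of y] sd_pos[of z]
    by (auto intro!: divide_left_mono mult_pos_pos)
qed

text \<open>The sum \<open>phi (x + v) + phi (x - v)\<close> is
  \<open>2 * exp (- (x^2 / 2)) * phi v\<close> times the hyperbolic cosine of \<open>x * v\<close>,
  which is at least 1.\<close>

lemma Psi_diff_ge:
  assumes "0 \<le> y"
  shows "2 * exp (- (x\<^sup>2 / 2)) * Psi y \<le> Psi (x + y) - Psi (x - y)"
proof -
  let ?f = "\<lambda>y. Psi (x + y) - Psi (x - y) - 2 * exp (- (x\<^sup>2 / 2)) * Psi y"
  have "?f 0 \<le> ?f y"
  proof (rule DERIV_nonneg_imp_nondecreasing[OF assms])
    fix v :: real
    have p: "phi (x + d * v) = exp (- (x\<^sup>2 / 2)) * phi v * exp (- (d * x * v))" if "d\<^sup>2 = 1" for d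
    proof -
      have "- ((x + d * v)\<^sup>2 / 2) = - (x\<^sup>2 / 2) + (- ((d\<^sup>2 * v\<^sup>2) / 2) + - (d * x * v))"
        by (simp add: power2_eq_square field_simps)
      then show ?thesis
        using that by (simp only: phi_eq exp_add) simp
    qed
    have "0 \<le> (exp (x * v / 2) - exp (- (x * v / 2)))\<^sup>2" by simp
    then have cosh: "2 \<le> exp (x * v) + exp (- (x * v))"
      by (simp add: power2_eq_square algebra_simps exp_add[symmetric])
    have "(?f has_real_derivative phi (x + v) + phi (x - v) - 2 * exp (- (x\<^sup>2 / 2)) * phi v) (at v)"
      by (auto intro!: derivative_eq_intros)
    moreover have "phi (x + v) + phi (x - v) - 2 * exp (- (x\<^sup>2 / 2)) * phi v
        = exp (- (x\<^sup>2 / 2)) * phi v * (exp (x * v) + exp (- (x * v)) - 2)"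
      using p[of 1] p[of "- 1"] by (simp add: algebra_simps)
    moreover have "0 \<le> exp (- (x\<^sup>2 / 2)) * phi v * (exp (x * v) + exp (- (x * v)) - 2)"
      using cosh phi_pos[of v] by simp
    ultimately show "\<exists>d. (?f has_real_derivative d) (at v) \<and> 0 \<le> d" by auto
  qed
  then show ?thesis by simp
qed

text \<open>Equality holds at \<open>y = 0\<close>, and the left side decreases in \<open>y\<close>.
  The comparison \<open>w <= q\<close> is \<open>sd_exp_antimono\<close> in disguise, because
  \<open>(x + v)^2 / 4\<close> exceeds \<open>(x - v)^2 / 4\<close> by \<open>x * v\<close>; the
  term with \<open>Psi y\<close> is paid for by \<open>Psi_diff_ge\<close>.\<close>

lemma sd_mult_sd_le:
  assumes x: "0 \<le> x" and y: "0 \<le> y"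
  shows "sd (x + y) * sd (x - y) + exp (- x\<^sup>2) * (Psi y)\<^sup>2 \<le> (sd x)\<^sup>2"
proof -
  let ?F = "\<lambda>y. sd (x + y) * sd (x - y) + exp (- x\<^sup>2) * (Psi y)\<^sup>2"
  have "?F y \<le> ?F 0"
  proof (rule DERIV_nonpos_imp_nonincreasing[OF y])
    fix v assume v: "0 \<le> v" "v \<le> y"
    define A B q w where "A = Psi (x + v)" and "B = Psi (x - v)"
      and "q = sd (x - v) / sd (x + v)" and "w = exp (x * v)"
    have xv: "\<bar>x - v\<bar> \<le> \<bar>x + v\<bar>" using x v by auto
    have w1: "1 \<le> w" using x v by (simp add: w_def)
    have wq: "w \<le> q"
    proof -
      have "(x + v)\<^sup>2 / 4 = x * v + (x - v)\<^sup>2 / 4"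
        by (simp add: power2_eq_square field_simps)
      then have "exp ((x + v)\<^sup>2 / 4) = w * exp ((x - v)\<^sup>2 / 4)"
        unfolding w_def exp_add[symmetric] by (simp only:)
      then have "sd (x + v) * w * exp ((x - v)\<^sup>2 / 4) \<le> sd (x - v) * exp ((x - v)\<^sup>2 / 4)"
        using sd_exp_antimono[OF xv] by (simp only: mult.assoc)
      then have "sd (x + v) * w \<le> sd (x - v)"
        by (rule mult_right_le_imp_le) simp
      then show ?thesis
        using sd_pos[of "x + v"] by (simp add: q_def field_simps)
    qed
    have "\<bar>B\<bar> \<le> A"
      using xv x v unfolding A_def B_def abs_Psi by (intro Psi_mono) auto
    moreover have "\<bar>B * (w / q)\<bar> \<le> \<bar>B\<bar>"
    proof -
      have "\<bar>w / q\<bar> \<le> 1" using wq w1 by simp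
      then show ?thesis
        unfolding abs_mult by (intro mult_left_le) auto
    qed
    \<comment> \<open>In units of \<open>phi (x + v)\<close> the aim is
      \<open>w * (A - B) <= A * q - B * w^2 / q\<close>. The difference of the two sides factors as
      \<open>(q - w) * (A + B * (w / q))\<close>.\<close>
    ultimately have "0 \<le> A + B * (w / q)"
      by linarith
    then have "0 \<le> phi (x + v) * ((q - w) * (A + B * (w / q)))"
      using wq phi_pos[of "x + v"] by (intro mult_nonneg_nonneg) auto
    moreover have "phi (x - v) = phi (x + v) * w\<^sup>2"
    proof -
      have "- ((x - v)\<^sup>2 / 2) = - ((x + v)\<^sup>2 / 2) + (x * v + x * v)"
        by (simp add: power2_eq_square field_simps)
      then show ?thesis
        unfolding phi_eq w_def power2_eq_square[of "exp _"] by (simp only: exp_add) simp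
    qed
    ultimately have "phi (x + v) * w * (A - B) \<le> phi (x + v) * A * q - phi (x - v) * B / q"
      using wq w1 by (simp add: field_simps power2_eq_square)
    moreover have "phi (x + v) * w = exp (- (x\<^sup>2 / 2)) * phi v"
    proof -
      have "- ((x + v)\<^sup>2 / 2) + x * v = - (x\<^sup>2 / 2) + - (v\<^sup>2 / 2)"
        by (simp add: power2_eq_square field_simps)
      then show ?thesis
        unfolding phi_eq w_def by (simp add: exp_add[symmetric])
    qed
    moreover have "exp (- (x\<^sup>2 / 2)) * phi v * (2 * exp (- (x\<^sup>2 / 2)) * Psi v)
        \<le> exp (- (x\<^sup>2 / 2)) * phi v * (A - B)"
      unfolding A_def B_def using phi_pos[of v] v by (intro mult_left_mono Psi_diff_ge) auto
    moreover have "exp (- (x\<^sup>2 / 2)) * phi v * (2 * exp (- (x\<^sup>2 / 2)) * Psi v)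
        = exp (- x\<^sup>2) * (2 * Psi v * phi v)"
    proof -
      have "exp (- (x\<^sup>2 / 2)) * exp (- (x\<^sup>2 / 2)) = exp (- x\<^sup>2)"
        unfolding exp_add[symmetric] by simp
      then show ?thesis by (metis (no_types, lifting) mult.assoc mult.commute mult.left_commute)
    qed
    ultimately have "exp (- x\<^sup>2) * (2 * Psi v * phi v) - (phi (x + v) * A * q - phi (x - v) * B / q) \<le> 0"
      by simp
    moreover have "(?F has_real_derivative
        exp (- x\<^sup>2) * (2 * Psi v * phi v) - (phi (x + v) * A * q - phi (x - v) * B / q)) (at v)"
      unfolding A_def B_def q_def
      by (rule derivative_eq_intros refl | simp)+
    ultimately show "\<exists>d. (?F has_real_derivative d) (at v) \<and> d \<le> 0" by blast
  qed
  then show ?thesis by (simp add: power2_eq_square)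
qed

text \<open>In \<open>kern x 0 s - kern x y s\<close> the dependence on \<open>x\<close> is the
  factor \<open>exp (- (x^2 / (1 - s)))\<close>, at most \<open>exp (- x^2)\<close> for all
  \<open>s\<close>. What remains is the case \<open>x = 0\<close>, where the decrease of
  \<open>JJ\<close> is at most \<open>r * (Psi y)^2\<close>; this matches the term in
  \<open>sd_mult_sd_le\<close>.\<close>

lemma loss_le_diagonal:
  assumes r: "0 \<le> r" "r < 1" and x: "0 \<le> x"
  shows "r * (sd (x + y) * sd (x - y)) - JJ x y r \<le> r * (sd x)\<^sup>2 - JJ x 0 r"
proof -
  have *: "r * (sd (x + y) * sd (x - y)) - JJ x y r \<le> r * (sd x)\<^sup>2 - JJ x 0 r" if y: "0 \<le> y" for y
  proof -
    have "JJ x 0 r - JJ x y r = integral {0..r} (\<lambda>s. kern x 0 s - kern x y s)"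
      unfolding JJ_def by (rule integral_diff[symmetric]; rule kern_integrable[OF r(2)])
    also have "\<dots> \<le> integral {0..r} (\<lambda>s. exp (- x\<^sup>2) * (kern 0 0 s - kern 0 y s))"
    proof (rule integral_le)
      fix s assume "s \<in> {0..r}"
      then have s: "0 \<le> s" "s < 1" using r by auto
      have "kern x v s = exp (- (x\<^sup>2 / (1 - s))) * kern 0 v s" for v
        by (simp add: kern_def exp_diff exp_minus field_simps)
      then have "kern x 0 s - kern x y s = exp (- (x\<^sup>2 / (1 - s))) * (kern 0 0 s - kern 0 y s)"
        by (simp add: algebra_simps)
      moreover have "kern 0 y s \<le> kern 0 0 s"
        unfolding kern_def using s one_minus_sq_pos[OF s] by (intro divide_right_mono) auto
      moreover have "x\<^sup>2 \<le> x\<^sup>2 / (1 - s)"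
        using s by (simp add: le_divide_eq mult_left_le)
      ultimately show "kern x 0 s - kern x y s \<le> exp (- x\<^sup>2) * (kern 0 0 s - kern 0 y s)"
        by (auto intro!: mult_right_mono)
    qed (intro integrable_diff integrable_on_mult_right kern_integrable r)+
    also have "\<dots> = exp (- x\<^sup>2) * (JJ 0 0 r - JJ 0 y r)"
      unfolding JJ_def by (simp add: integral_diff kern_integrable[OF r(2)])
    also have "\<dots> \<le> exp (- x\<^sup>2) * (r * (Psi y)\<^sup>2)"
      using sd_sq_minus_JJ_antimono[OF r order_refl y]
      by (intro mult_left_mono) (auto simp: sd_sq algebra_simps)
    also have "\<dots> = r * (exp (- x\<^sup>2) * (Psi y)\<^sup>2)" by simp
    also have "\<dots> \<le> r * ((sd x)\<^sup>2 - sd (x + y) * sd (x - y))"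
      using sd_mult_sd_le[OF x y] r by (intro mult_left_mono) auto
    finally show ?thesis by (simp add: algebra_simps)
  qed
  show ?thesis
    using *[of y] *[of "- y"] by (cases "0 \<le> y") (auto simp: mult.commute)
qed

text \<open>Gebelein's inequality for unequal thresholds, by a Cauchy-Schwarz argument: the density
  is at most the geometric mean of the two equal-threshold densities. The weight \<open>l\<close> in
  the arithmetic-geometric mean step makes both resulting bounds equal to
  \<open>r * (sd u * sd t)\<close>.\<close>

lemma JJ_le_sd_mult_sd:
  assumes r: "0 \<le> r" "r < 1"
  shows "JJ ((u - t) / 2) ((u + t) / 2) r \<le> r * (sd u * sd t)"
proof -
  define l where "l = sd t / sd u"
  have l: "0 < l" using sd_pos by (simp add: l_def)
  have "JJ ((u - t) / 2) ((u + t) / 2) r \<le> integral {0..r} (\<lambda>s. (l * kern 0 u s + kern 0 t s / l) / 2)"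
    unfolding JJ_def
  proof (rule integral_le[OF kern_integrable[OF r(2)]])
    fix s assume "s \<in> {0..r}"
    then have s: "0 \<le> s" "s < 1" using r by auto
    define a b c where "a = exp (- (u\<^sup>2 / (1 + s)) / 2)" and "b = exp (- (t\<^sup>2 / (1 + s)) / 2)"
      and "c = 1 / (2 * pi * sqrt (1 - s\<^sup>2))"
    have c: "0 \<le> c" using one_minus_sq_pos[OF s] by (simp add: c_def)
    have "kern 0 u s = a\<^sup>2 * c" "kern 0 t s = b\<^sup>2 * c"
    proof -
      have "(exp (- z / 2))\<^sup>2 = exp (- z)" for z :: real
        by (simp add: power2_eq_square exp_add[symmetric])
      note e = this[of "u\<^sup>2 / (1 + s)"] this[of "t\<^sup>2 / (1 + s)"]
      show "kern 0 u s = a\<^sup>2 * c" "kern 0 t s = b\<^sup>2 * c"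
        unfolding a_def b_def e by (simp_all add: c_def kern_def)
    qed
    moreover have "kern ((u - t) / 2) ((u + t) / 2) s \<le> a * b * c"
    proof -
      \<comment> \<open>Replacing \<open>1 - s\<close> by \<open>1 + s\<close> only enlarges the
        exponential, and makes the exponent split into a part in \<open>u\<close> and a part in
        \<open>t\<close>.\<close>
      have "((u - t) / 2)\<^sup>2 / (1 + s) \<le> ((u - t) / 2)\<^sup>2 / (1 - s)"
        using s by (intro divide_left_mono) auto
      moreover have "((u - t) / 2)\<^sup>2 / (1 + s) + ((u + t) / 2)\<^sup>2 / (1 + s) = (u\<^sup>2 / (1 + s)) / 2 + (t\<^sup>2 / (1 + s)) / 2"
      proof -
        have "((u - t) / 2)\<^sup>2 * z + ((u + t) / 2)\<^sup>2 * z = (u\<^sup>2 * z) / 2 + (t\<^sup>2 * z) / 2" for z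
          by (simp add: power2_eq_square field_simps)
        from this[of "inverse (1 + s)", folded divide_inverse] show ?thesis .
      qed
      ultimately have "exp (- (((u - t) / 2)\<^sup>2 / (1 - s)) - ((u + t) / 2)\<^sup>2 / (1 + s)) \<le> a * b"
        unfolding a_def b_def exp_add[symmetric] exp_le_cancel_iff by linarith
      then show ?thesis
        using mult_right_mono[OF _ c] by (simp add: kern_def c_def)
    qed
    moreover have "a * b * c \<le> (l * (a\<^sup>2 * c) + (b\<^sup>2 * c) / l) / 2"
    proof -
      have "0 \<le> c / l * (l * a - b)\<^sup>2"
        using c l by simp
      then show ?thesis
        using l by (simp add: field_simps power2_eq_square)
    qed
    ultimately show "kern ((u - t) / 2) ((u + t) / 2) s \<le> (l * kern 0 u s + kern 0 t s / l) / 2"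
      by simp
  qed (intro integrable_on_divide integrable_add integrable_on_mult_right kern_integrable r)
  also have "\<dots> = (l * JJ 0 u r + JJ 0 t r / l) / 2"
    unfolding JJ_def using kern_integrable[OF r(2)]
    by (simp add: integral_add integrable_on_mult_right integrable_on_divide)
  also have "\<dots> \<le> (l * (r * (sd u)\<^sup>2) + (r * (sd t)\<^sup>2) / l) / 2"
    using l by (intro divide_right_mono add_mono mult_left_mono JJ_right_le[OF r]) auto
  also have "\<dots> = r * (sd u * sd t)"
    using sd_pos[of u] sd_pos[of t] by (simp add: l_def field_simps power2_eq_square)
  finally show ?thesis .
qed

text \<open>After taking logarithms: the log-odds \<open>l\<close> of exceeding a threshold satisfy
  \<open>l (x + y) + l (x - y) <= 2 * l x\<close>. As \<open>l\<close> is odd, it is concave only to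
  the right of 0; for \<open>x >= 0\<close> it is enough that the slope at \<open>x + v\<close> is
  at least as steep as at \<open>x - v\<close>, which is closer to 0.\<close>

lemma odds_product_le:
  assumes x: "0 \<le> x"
  shows "(1 / 2 - Psi (x + y)) * (1 / 2 - Psi (x - y)) * (1 / 2 + Psi x)\<^sup>2
    \<le> (1 / 2 - Psi x)\<^sup>2 * ((1 / 2 + Psi (x + y)) * (1 / 2 + Psi (x - y)))"
proof -
  define l where "l v = ln (1 / 2 - Psi v) - ln (1 / 2 + Psi v)" for v
  have pos: "0 < 1 / 2 - Psi v" "0 < 1 / 2 + Psi v" for v
    using Psi_less_half[of v] Psi_gt_minus_half[of v] by auto
  have l': "(l has_real_derivative - (phi v / (sd v)\<^sup>2)) (at v)" for v
  proof -
    have "(l has_real_derivative - phi v / (1 / 2 - Psi v) - phi v / (1 / 2 + Psi v)) (at v)"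
      unfolding l_def using pos[of v] by (auto intro!: derivative_eq_intros simp: field_simps)
    moreover have "- phi v / (1 / 2 - Psi v) - phi v / (1 / 2 + Psi v)
        = - (phi v / ((1 / 2 - Psi v) * (1 / 2 + Psi v)))"
    proof -
      have "- p / a - p / b = - (p / (a * b))" if "0 < a" "0 < b" "a + b = 1" for p a b :: real
      proof -
        have "- p / a - p / b = - (p * (a + b) / (a * b))"
          using that(1,2) by (simp add: field_simps)
        then show ?thesis using that(3) by simp
      qed
      then show ?thesis using pos[of v] by simp
    qed
    moreover have "(1 / 2 - Psi v) * (1 / 2 + Psi v) = (sd v)\<^sup>2"
      unfolding sd_sq by (simp add: power2_eq_square algebra_simps)
    ultimately show ?thesis by simp
  qed
  have *: "l (x + y) + l (x - y) \<le> l (x + 0) + l (x - 0)" if y: "0 \<le> y" for y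
  proof (rule DERIV_nonpos_imp_nonincreasing[OF y])
    fix v assume v: "0 \<le> v" "v \<le> y"
    have "((\<lambda>v. l (x + v) + l (x - v)) has_real_derivative
        - (phi (x + v) / (sd (x + v))\<^sup>2) * 1 + - (phi (x - v) / (sd (x - v))\<^sup>2) * - 1) (at v)"
      by (intro DERIV_add DERIV_chain2[OF l']) (auto intro!: derivative_eq_intros)
    moreover have "phi (x - v) / (sd (x - v))\<^sup>2 \<le> phi (x + v) / (sd (x + v))\<^sup>2"
      using x v by (intro phi_div_sd_sq_mono) auto
    ultimately show "\<exists>d. ((\<lambda>v. l (x + v) + l (x - v)) has_real_derivative d) (at v) \<and> d \<le> 0"
      by (intro exI conjI) auto
  qed
  have "l (x + y) + l (x - y) \<le> 2 * l x"
    using *[of y] *[of "- y"] by (cases "0 \<le> y") auto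
  then have "ln ((1 / 2 - Psi (x + y)) * (1 / 2 - Psi (x - y)) * (1 / 2 + Psi x)\<^sup>2)
      \<le> ln ((1 / 2 - Psi x)\<^sup>2 * ((1 / 2 + Psi (x + y)) * (1 / 2 + Psi (x - y))))"
    using pos by (simp only: l_def ln_mult_pos mult_pos_pos zero_less_power ln_realpow) simp
  then show ?thesis
    using pos by (subst (asm) ln_le_cancel_iff) (simp_all only: mult_pos_pos zero_less_power)
qed

section \<open>Equal thresholds\<close>

definition expT :: "nat \<Rightarrow> real \<Rightarrow> real" where
  "expT n z = (\<Sum>k\<le>n. (- z) ^ k / fact k)"

text \<open>Termwise integral of \<open>expT n (x^2 / 2)\<close>, so it approximates
  \<open>sqrt (2 * pi) * Psi x\<close>. Leaving that constant out keeps the values at rational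
  points rational.\<close>

definition PsiT :: "nat \<Rightarrow> real \<Rightarrow> real" where
  "PsiT n x = (\<Sum>k\<le>n. (- 1) ^ k * x ^ (2 * k + 1) / (2 ^ k * fact k * real (2 * k + 1)))"

lemma expT_0 [simp]: "expT 0 z = 1"
  by (simp add: expT_def)

lemma expT_Suc: "expT (Suc n) z = expT n z + (- z) ^ Suc n / fact (Suc n)"
  unfolding expT_def by simp

lemma expT_deriv: "(expT (Suc n) has_real_derivative - expT n z) (at z)"
proof (induction n)
  case 0
  have "expT (Suc 0) = (\<lambda>z. 1 - z)"
    by (simp add: fun_eq_iff expT_Suc)
  then show ?case by (auto intro!: derivative_eq_intros)
next
  case (Suc n)
  have "((\<lambda>z. (- z) ^ Suc (Suc n)) has_real_derivative real (Suc (Suc n)) * (- 1) * (- z) ^ Suc n) (at z)"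
    by (rule derivative_eq_intros refl)+ (simp del: of_nat_Suc power_Suc)
  from DERIV_add[OF Suc DERIV_cdivide[OF this, of "fact (Suc (Suc n))"]]
  have "((\<lambda>z. expT (Suc n) z + (- z) ^ Suc (Suc n) / fact (Suc (Suc n))) has_real_derivative
      - expT n z + real (Suc (Suc n)) * (- 1) * (- z) ^ Suc n / fact (Suc (Suc n))) (at z)" .
  moreover have "real (Suc (Suc n)) * (- 1) * (- z) ^ Suc n / fact (Suc (Suc n)) = - ((- z) ^ Suc n / fact (Suc n))"
  proof -
    have "real (Suc (Suc n)) * (- 1) * a / fact (Suc (Suc n)) = - (a / fact (Suc n))" for a :: real
      unfolding fact_Suc[of "Suc n"] of_nat_mult
      by (simp del: of_nat_Suc fact_Suc add: field_simps)
    then show ?thesis .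
  qed
  ultimately show ?case
    by (simp only: expT_Suc[of "Suc n", abs_def] expT_Suc[of n z]) simp
qed

text \<open>Successive remainders are antiderivatives of each other up to sign, and all vanish at 0,
  so their signs alternate.\<close>

lemma expT_bounds:
  assumes "0 \<le> z"
  shows "0 \<le> (- 1) ^ n * (expT n z - exp (- z))"
  using assms
proof (induction n arbitrary: z)
  case 0
  then show ?case by simp
next
  case (Suc n)
  let ?g = "\<lambda>z. (- 1) ^ Suc n * (expT (Suc n) z - exp (- z))"
  have "?g 0 \<le> ?g z"
  proof (rule DERIV_nonneg_imp_nondecreasing[OF \<open>0 \<le> z\<close>])
    fix v :: real assume "0 \<le> v" "v \<le> z"
    have "(?g has_real_derivative (- 1) ^ n * (expT n v - exp (- v))) (at v)"
      by (rule derivative_eq_intros expT_deriv refl | simp)+ (simp add: algebra_simps)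
    then show "\<exists>d. (?g has_real_derivative d) (at v) \<and> 0 \<le> d"
      using Suc.IH[OF \<open>0 \<le> v\<close>] by blast
  qed
  moreover have "expT m 0 = 1" for m
    by (induction m) (simp_all add: expT_Suc)
  ultimately show ?case by simp
qed

lemma PsiT_deriv: "(PsiT n has_real_derivative expT n (x\<^sup>2 / 2)) (at x)"
proof -
  have "((\<lambda>x. (- 1) ^ k * x ^ (2 * k + 1) / (2 ^ k * fact k * real (2 * k + 1)))
      has_real_derivative (- (x\<^sup>2 / 2)) ^ k / fact k) (at x)" for k
  proof -
    define d where "d = real (2 * k + 1)"
    have d: "0 < d" by (simp add: d_def)
    have "((\<lambda>x. x ^ (2 * k + 1)) has_real_derivative d * x ^ (2 * k)) (at x)"
      unfolding d_def by (rule derivative_eq_intros refl | simp)+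
    then have "((\<lambda>x. (- 1) ^ k * x ^ (2 * k + 1) / (2 ^ k * fact k * d))
        has_real_derivative (- 1) ^ k * (d * x ^ (2 * k)) / (2 ^ k * fact k * d)) (at x)"
      by (intro DERIV_cdivide DERIV_cmult)
    moreover have "(- 1) ^ k * (d * x ^ (2 * k)) / (2 ^ k * fact k * d) = (- (x\<^sup>2 / 2)) ^ k / fact k"
      using d by (simp add: power_mult power_minus[of "x\<^sup>2 / 2"] power_divide)
    ultimately show ?thesis by (simp only: d_def)
  qed
  then show ?thesis
    unfolding PsiT_def[abs_def] expT_def by (intro DERIV_sum)
qed

lemma PsiT_bounds:
  assumes "0 \<le> x"
  shows "0 \<le> (- 1) ^ n * (PsiT n x / sqrt (2 * pi) - Psi x)"
proof -
  let ?g = "\<lambda>x. (- 1) ^ n * (PsiT n x / sqrt (2 * pi) - Psi x)"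
  have "?g 0 \<le> ?g x"
  proof (rule DERIV_nonneg_imp_nondecreasing[OF assms])
    fix v :: real
    have "(?g has_real_derivative (- 1) ^ n * (expT n (v\<^sup>2 / 2) / sqrt (2 * pi) - phi v * 1)) (at v)"
      by (intro DERIV_cmult DERIV_diff DERIV_cdivide PsiT_deriv Psi_deriv DERIV_ident)
    moreover have "0 \<le> (- 1) ^ n * (expT n (v\<^sup>2 / 2) - exp (- (v\<^sup>2 / 2))) / sqrt (2 * pi)"
      by (intro divide_nonneg_nonneg expT_bounds) auto
    then have "0 \<le> (- 1) ^ n * (expT n (v\<^sup>2 / 2) / sqrt (2 * pi) - phi v * 1)"
      by (simp add: phi_eq diff_divide_distrib right_diff_distrib)
    ultimately show "\<exists>d. (?g has_real_derivative d) (at v) \<and> 0 \<le> d" by blast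
  qed
  moreover have "PsiT n 0 = 0" by (simp add: PsiT_def)
  ultimately show ?thesis by simp
qed

lemma Psi_le_linear: "0 \<le> x \<Longrightarrow> Psi x \<le> x / sqrt (2 * pi)"
  using PsiT_bounds[of x 0] by (simp add: PsiT_def)

lemma Psi_ge_cubic: "0 \<le> x \<Longrightarrow> (x - x ^ 3 / 6) / sqrt (2 * pi) \<le> Psi x"
  using PsiT_bounds[of x 1] by (simp add: PsiT_def eval_nat_numeral)

lemma Psi_ge_linear:
  assumes "0 \<le> x" "x \<le> c"
  shows "x * (1 - c\<^sup>2 / 6) / sqrt (2 * pi) \<le> Psi x"
proof -
  have "x * x\<^sup>2 \<le> x * c\<^sup>2"
    using assms by (intro mult_left_mono power_mono) auto
  then have "x * (1 - c\<^sup>2 / 6) \<le> x - x ^ 3 / 6"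
    by (simp add: algebra_simps power3_eq_cube power2_eq_square)
  then show ?thesis
    using Psi_ge_cubic[OF assms(1)] by (meson divide_right_mono order_trans real_sqrt_ge_zero pi_ge_zero mult_nonneg_nonneg zero_le_numeral)
qed

lemma sqrt_2pi_bounds: "2.5066282 \<le> sqrt (2 * pi)" "sqrt (2 * pi) \<le> 2.5066283"
proof -
  show "2.5066282 \<le> sqrt (2 * pi)"
    using pi_approx(1) by (intro real_le_rsqrt) (simp add: power2_eq_square)
  show "sqrt (2 * pi) \<le> 2.5066283"
    using pi_approx(2) by (intro real_le_lsqrt) (simp_all add: power2_eq_square)
qed

text \<open>The largest admissible \<open>r\<close> for equal thresholds \<open>x\<close> is \<open>(1 - b) / (1 + b)\<close> with \<open>b = 2 * Psi x\<close>.\<close>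

lemma Psi_scaled_ge:
  assumes b: "0 < b" "b \<le> 3 / 8" and x: "0 \<le> x" "2 * Psi x \<le> b"
  shows "2 / (1 + b) * Psi x \<le> Psi (x / sqrt b)"
proof -
  define z where "z = sqrt b"
  have z: "0 < z" "z\<^sup>2 = b" using b by (auto simp: z_def)
  define p where "p = 2 * Psi x"
  have p: "0 \<le> p" "p \<le> z\<^sup>2" using x Psi_nonneg[OF x(1)] z by (auto simp: p_def)
  define c where "c = sqrt (2 * pi)"
  have c: "0 < c" "c\<^sup>2 = 2 * pi" by (auto simp: c_def)
  \<comment> \<open>\<open>x\<close> is controlled only through \<open>Psi x\<close>. By
    \<open>Psi_le_linear\<close>, \<open>v\<close> is a lower bound for \<open>x / sqrt b\<close>
    that is computed from \<open>Psi x\<close>.\<close>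
  define v where "v = p * c / (2 * z)"
  have v: "0 \<le> v" using p c z by (simp add: v_def)
  have "p / z \<le> z"
    using p z by (simp add: divide_le_eq power2_eq_square)
  then have "v \<le> z * c / 2"
    using mult_right_mono[of "p / z" z "c / 2"] c by (simp add: v_def)
  then have "v * (1 - (z * c / 2)\<^sup>2 / 6) / c \<le> Psi v"
    unfolding c_def by (rule Psi_ge_linear[OF v])
  moreover have "v \<le> x / z"
  proof -
    have "Psi x * c \<le> x"
      using Psi_le_linear[OF x(1), folded c_def] c(1) by (simp add: le_divide_eq)
    then show ?thesis
      using z by (simp add: v_def p_def divide_right_mono)
  qed
  then have "Psi v \<le> Psi (x / z)"
    by (rule Psi_mono)
  moreover have "v * (1 - (z * c / 2)\<^sup>2 / 6) / c = p / (2 * z) * (1 - b * pi / 12)"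
    using c(1) z by (simp add: v_def power_mult_distrib power_divide c(2))
  \<comment> \<open>This amounts to \<open>2 * sqrt b <= (1 + b) * (1 - b * pi / 12)\<close>, which
    fails already at \<open>b = 0.4\<close> and so limits the range of \<open>b\<close>. The number
    \<open>6125 / 10000\<close> is \<open>sqrt (3 / 8)\<close> rounded up, \<open>4 / 15\<close> is
    \<open>3.2 / 12\<close>.\<close>
  moreover have "p / (1 + b) \<le> p / (2 * z) * (1 - b * pi / 12)"
  proof -
    have "b * pi \<le> b * 3.2"
      using pi_approx(2) b by (intro mult_left_mono) auto
    then have a: "1 - b * (4 / 15) \<le> 1 - b * pi / 12" by (simp add: mult.commute[of pi])
    have "z \<le> 6125 / 10000"
      unfolding z_def by (rule real_le_lsqrt) (use b in \<open>auto simp: power2_eq_square\<close>)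
    moreover have "0 \<le> (z - 6125 / 10000)\<^sup>2" by simp
    then have "1225 / 1000 * z - 3752 / 10000 \<le> b"
      unfolding z(2)[symmetric] by (simp add: power2_eq_square algebra_simps)
    moreover have "b * b \<le> b * (3 / 8)"
      using b by (intro mult_left_mono) auto
    ultimately have "2 * z \<le> 1 + b * (11 / 15) - (b * b) * (4 / 15)"
      by linarith
    also have "\<dots> = (1 - b * (4 / 15)) * (1 + b)"
      by (simp add: field_simps)
    also have "\<dots> \<le> (1 - b * pi / 12) * (1 + b)"
      using a b by (intro mult_right_mono) auto
    finally have "2 * z \<le> (1 - b * pi / 12) * (1 + b)" .
    then have "1 / (1 + b) \<le> (1 - b * pi / 12) / (2 * z)"
      using z b by (simp add: field_simps)
    from mult_left_mono[OF this p(1)] show ?thesis by simp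
  qed
  ultimately show ?thesis by (simp add: p_def z_def)
qed

text \<open>With this \<open>r\<close>, \<open>1 + r = 2 / (1 + b)\<close> and
  \<open>(1 + r) / (1 - r) = 1 / b\<close>, so the sign of the \<open>x\<close>-derivative is
  exactly the inequality \<open>Psi_scaled_ge\<close>.\<close>

lemma diagonal_loss_mono:
  assumes b: "0 < b" "b \<le> 3 / 8" and r: "r = (1 - b) / (1 + b)"
    and x: "0 \<le> x" "x \<le> t" "2 * Psi t \<le> b"
  shows "r * (sd x)\<^sup>2 - JJ x 0 r \<le> r * (sd t)\<^sup>2 - JJ t 0 r"
proof -
  have r01: "0 \<le> r" "r < 1" using b r by auto
  have "1 + r = 2 / (1 + b)" "1 - r = 2 * b / (1 + b)"
    using b by (simp_all add: r field_simps)
  then have k: "(1 + r) / (1 - r) = 1 / b"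
  proof -
    have "(2 / a) / (2 * b / a) = 1 / b" if "0 < a" for a
      using b that by (simp add: field_simps)
    from this[of "1 + b"] show ?thesis
      using b unfolding \<open>1 + r = 2 / (1 + b)\<close> \<open>1 - r = 2 * b / (1 + b)\<close> by simp
  qed
  let ?g = "\<lambda>x. r * (1 / 4 - (Psi x)\<^sup>2) - JJ x 0 r"
  have "?g x \<le> ?g t"
  proof (rule DERIV_nonneg_imp_nondecreasing[OF x(2)])
    fix v assume v: "x \<le> v" "v \<le> t"
    have "(?g has_real_derivative 2 * phi v * (Psi (v * sqrt ((1 + r) / (1 - r))) - (1 + r) * Psi v)) (at v)"
      by (rule derivative_eq_intros JJ_deriv_left[OF r01] refl | simp)+ (simp add: algebra_simps)
    moreover have "(1 + r) * Psi v \<le> Psi (v * sqrt ((1 + r) / (1 - r)))"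
      using Psi_scaled_ge[OF b, of v] v x Psi_mono[OF v(2)]
      by (simp add: k real_sqrt_divide) (simp add: \<open>1 + r = 2 / (1 + b)\<close>)
    then have "0 \<le> 2 * phi v * (Psi (v * sqrt ((1 + r) / (1 - r))) - (1 + r) * Psi v)"
      using phi_pos[of v] by simp
    ultimately show "\<exists>d. (?g has_real_derivative d) (at v) \<and> 0 \<le> d" by blast
  qed
  then show ?thesis by (simp add: sd_sq)
qed

text \<open>At \<open>r = 5 / 11\<close> the boundary value \<open>(1 - r) / (1 + r)\<close> is
  \<open>3 / 8\<close>, the limit of the monotonicity argument. For \<open>x >= 3 / 4\<close> the
  constraint alone bounds the loss by \<open>(1 / 2 - Psi x)^2\<close>. For smaller
  \<open>x\<close>, \<open>1 / (1 - s) <= 11 / 6\<close> gives a lower bound on \<open>JJ\<close>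
  that is linear in \<open>r\<close>, and \<open>5 / 11 * 0.121 = 0.055\<close>.\<close>

lemma diagonal_loss_small_corr:
  assumes r: "0 \<le> r" "r \<le> 5 / 11" and x: "0 \<le> x" and rx: "r * (1 / 2 + Psi x) \<le> 1 / 2 - Psi x"
  shows "r * (sd x)\<^sup>2 - JJ x 0 r \<le> 0.055"
proof (cases "3 / 4 \<le> x")
  case True
  have "(3 / 4 - (3 / 4) ^ 3 / 6) / 2.5066283 \<le> (3 / 4 - (3 / 4) ^ 3 / 6) / sqrt (2 * pi)"
    using sqrt_2pi_bounds by (intro divide_left_mono) (auto simp: power3_eq_cube)
  then have "0.271 \<le> Psi x"
    using Psi_ge_cubic[of "3 / 4"] Psi_mono[OF True] by (simp add: power3_eq_cube)
  then have p: "0 \<le> 1 / 2 - Psi x" "1 / 2 - Psi x \<le> 0.229"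
    using Psi_less_half[of x] by auto
  have "r * (sd x)\<^sup>2 = r * (1 / 2 + Psi x) * (1 / 2 - Psi x)"
    unfolding sd_sq by (simp add: power2_eq_square algebra_simps)
  also have "\<dots> \<le> (1 / 2 - Psi x) * (1 / 2 - Psi x)"
    using rx p by (intro mult_right_mono) auto
  also have "\<dots> \<le> 0.229 * 0.229"
    using p by (intro mult_mono) auto
  finally show ?thesis
    using JJ_nonneg[of r x 0] r by simp
next
  case False
  define q where "q = x\<^sup>2"
  define e where "e = exp (- (11 / 6 * q))"
  have q: "0 \<le> q" "q \<le> 0.5625"
    using False x power_mono[of x "3 / 4" 2] by (auto simp: q_def power2_eq_square)
  have "integral {0..r} (\<lambda>s. e / (2 * pi)) \<le> integral {0..r} (kern x 0)"
  proof (rule integral_le)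
    fix s assume "s \<in> {0..r}"
    then have s: "0 \<le> s" "s \<le> 5 / 11" using r by auto
    have "1 / (1 - s) \<le> 11 / 6" using s by (simp add: field_simps)
    from mult_left_mono[OF this q(1)] have "exp (- (11 / 6 * q)) \<le> exp (- (x\<^sup>2 / (1 - s)))"
      by (simp add: q_def)
    moreover have "0 < sqrt (1 - s\<^sup>2)" "sqrt (1 - s\<^sup>2) \<le> 1"
      using one_minus_sq_pos[of s] s by auto
    ultimately have "e / (2 * pi * 1) \<le> exp (- (x\<^sup>2 / (1 - s))) / (2 * pi * sqrt (1 - s\<^sup>2))"
      unfolding e_def by (intro frac_le mult_left_mono) (auto intro!: mult_pos_pos)
    then show "e / (2 * pi) \<le> kern x 0 s" by (simp add: kern_def)
  qed (use r in \<open>auto intro!: kern_integrable\<close>)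
  then have J: "r * (e / (2 * pi)) \<le> JJ x 0 r"
    using r by (simp add: JJ_def)
  have P: "(q - q\<^sup>2 / 3) / (2 * pi) \<le> (Psi x)\<^sup>2"
  proof -
    have "((x - x ^ 3 / 6) / sqrt (2 * pi))\<^sup>2 \<le> (Psi x)\<^sup>2"
    proof (rule power_mono[OF Psi_ge_cubic[OF x]])
      have "x * x\<^sup>2 \<le> x * 6" using q x by (intro mult_left_mono) (auto simp: q_def)
      then show "0 \<le> (x - x ^ 3 / 6) / sqrt (2 * pi)"
        by (simp add: power3_eq_cube power2_eq_square)
    qed
    moreover have "(x - x ^ 3 / 6)\<^sup>2 = q - q\<^sup>2 / 3 + q ^ 3 / 36"
      by (simp add: q_def power2_eq_square power3_eq_cube algebra_simps)
    ultimately have "(q - q\<^sup>2 / 3 + q ^ 3 / 36) / (2 * pi) \<le> (Psi x)\<^sup>2"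
      by (simp add: power_divide)
    moreover have "(q - q\<^sup>2 / 3) / (2 * pi) \<le> (q - q\<^sup>2 / 3 + q ^ 3 / 36) / (2 * pi)"
      using q by (intro divide_right_mono) auto
    ultimately show ?thesis by linarith
  qed
  \<comment> \<open>Here \<open>258 / 1000\<close> is \<open>2 * (1 / 4 - 0.121)\<close>. The
    exponential is replaced by its tangent at \<open>1 / 2\<close> or at \<open>1\<close>, according
    to the side of \<open>q = 0.4\<close>.\<close>
  have "pi * (258 / 1000) \<le> q - q\<^sup>2 / 3 + e"
  proof -
    have pi_less: "pi \<le> 31416 / 10000"
      using pi_approx(2) by simp
    have tangent: "exp (- a) * (1 + a - z) \<le> exp (- z)" for a z :: real
      using mult_left_mono[OF exp_ge_add_one_self[of "a - z"], of "exp (- a)"]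
      by (simp add: exp_add[symmetric] algebra_simps)
    have e1: "0.3676 \<le> exp (- 1 :: real)"
      using e_less_272 by (simp add: exp_minus field_simps)
    have "(exp (1 / 2))\<^sup>2 = exp (1 :: real)"
      by (simp add: power2_eq_square exp_add[symmetric])
    then have "exp (1 / 2 :: real) \<le> 1.6493"
      using e_less_272 power2_le_imp_le[of "exp (1 / 2 :: real)" "1.6493"] by (simp add: power2_eq_square)
    then have e2: "0.6063 \<le> exp (- (1 / 2) :: real)"
      by (simp add: exp_minus field_simps)
    show ?thesis
    proof (cases "q \<le> 0.4")
      case True
      have "0.6063 * (1 + 1 / 2 - 11 / 6 * q) \<le> exp (- (1 / 2)) * (1 + 1 / 2 - 11 / 6 * q)"
        using True e2 by (intro mult_right_mono) auto
      also have "\<dots> \<le> e"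
        unfolding e_def by (rule tangent)
      finally have "90945 / 100000 - 66693 / 60000 * q \<le> e" by simp
      moreover have "0 \<le> q * (0.4 - q)" using True q by simp
      then have "q\<^sup>2 \<le> 4 / 10 * q" by (simp add: power2_eq_square algebra_simps)
      moreover have "q \<le> 4 / 10" using True by simp
      ultimately show ?thesis using q(1) pi_less by linarith
    next
      case False
      have "0.3676 * (1 + 1 - 11 / 6 * q) \<le> exp (- 1) * (1 + 1 - 11 / 6 * q)"
        using q e1 by (intro mult_right_mono) auto
      also have "\<dots> \<le> e"
        unfolding e_def by (rule tangent)
      finally have "7352 / 10000 - 40436 / 60000 * q \<le> e" by simp
      moreover have "(q - 0.4) * (0.5625 - q) = 9625 / 10000 * q - 225 / 1000 - q\<^sup>2"
        by (simp add: power2_eq_square field_simps)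
      then have "q\<^sup>2 \<le> 9625 / 10000 * q - 225 / 1000"
        using False q mult_nonneg_nonneg[of "q - 0.4" "0.5625 - q"] by simp
      moreover have "4 / 10 \<le> q" "q \<le> 5625 / 10000" using False q by auto
      ultimately show ?thesis using pi_less by linarith
    qed
  qed
  then have "0.129 \<le> (q - q\<^sup>2 / 3 + e) / (2 * pi)"
    by (simp add: le_divide_eq)
  then have "(sd x)\<^sup>2 - e / (2 * pi) \<le> 0.121"
    using P by (simp add: sd_sq add_divide_distrib diff_divide_distrib)
  then have "r * ((sd x)\<^sup>2 - e / (2 * pi)) \<le> r * (121 / 1000)"
    using r by (intro mult_left_mono) auto
  then have "r * (sd x)\<^sup>2 - r * (e / (2 * pi)) \<le> r * (121 / 1000)"
    by (simp only: right_diff_distrib)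
  then have "r * (sd x)\<^sup>2 - JJ x 0 r \<le> 55 / 1000"
    using J r by linarith
  then show ?thesis by simp
qed

text \<open>The correlation is near the optimal one and has \<open>arcsin r = pi / 4\<close>.
  Bounding the exponential by a linear function leaves integrands whose primitives are
  \<open>arcsin\<close> and the root from \<open>sqrt_quot_deriv\<close>.\<close>

lemma diagonal_loss_at_0_21: "0.055 \<le> sqrt (1 / 2) * (sd 0.21)\<^sup>2 - JJ 0.21 0 (sqrt (1 / 2))"
proof -
  define r where "r = sqrt (1 / 2 :: real)"

  have rb: "0.7071 \<le> r" "r \<le> 0.7072"
    unfolding r_def by (rule real_le_rsqrt real_le_lsqrt; simp add: power2_eq_square)+
  have r: "0 \<le> r" "r < 1" using rb by auto
  \<comment> \<open>The factor \<open>0.9\<close> belongs to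
    \<open>exp (- z) <= 1 - z + z^2 / 2 <= 1 - 0.9 * z\<close> for
    \<open>0 <= z <= 0.2\<close>.\<close>
  define c where "c = (0.9 * 0.21\<^sup>2 :: real)"
  have "integral {0..r} (kern 0.21 0)
      \<le> integral {0..r} (\<lambda>s. (1 / sqrt (1 - s\<^sup>2) - c * (1 / ((1 - s) * sqrt (1 - s\<^sup>2)))) / (2 * pi))"
  proof (rule integral_le[OF kern_integrable[OF r(2)]])
    have "1 - s \<noteq> 0" "sqrt (1 - s\<^sup>2) \<noteq> 0" if "s \<in> {0..r}" for s
      using one_minus_sq_pos[of s] that r by auto
    then show "(\<lambda>s. (1 / sqrt (1 - s\<^sup>2) - c * (1 / ((1 - s) * sqrt (1 - s\<^sup>2)))) / (2 * pi)) integrable_on {0..r}"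
      by (intro integrable_continuous_interval continuous_intros) auto
    fix s assume s: "s \<in> {0..r}"
    then have s': "0 \<le> s" "s < 1" using r by auto
    define z where "z = 0.21\<^sup>2 / (1 - s)"
    have "z \<le> 0.21\<^sup>2 / (1 - 0.7072)"
      unfolding z_def using s rb by (intro divide_left_mono) auto
    also have "0.21\<^sup>2 / (1 - 0.7072) \<le> (0.2 :: real)"
      by (simp add: power2_eq_square)
    finally have z: "z \<le> 0.2" "0 \<le> z"
      using s' by (auto simp: z_def)
    have "exp (- z) \<le> 1 - z + z\<^sup>2 / 2"
      using expT_bounds[OF z(2), of 2] by (simp add: expT_Suc numeral_2_eq_2)
    also have "z\<^sup>2 \<le> 0.2 * z"
      unfolding power2_eq_square by (rule mult_right_mono[OF z])
    finally have "exp (- z) \<le> 1 - 0.9 * z" by simp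
    also have "0.9 * z = c * (1 / (1 - s))"
      by (simp add: c_def z_def)
    finally have "exp (- z) \<le> 1 - c * (1 / (1 - s))" .
    then have "exp (- z) / sqrt (1 - s\<^sup>2) \<le> (1 - c * (1 / (1 - s))) / sqrt (1 - s\<^sup>2)"
      using one_minus_sq_pos[OF s'] by (intro divide_right_mono) auto
    then have "exp (- z) / sqrt (1 - s\<^sup>2) / (2 * pi) \<le> (1 / sqrt (1 - s\<^sup>2) - c * (1 / ((1 - s) * sqrt (1 - s\<^sup>2)))) / (2 * pi)"
      by (intro divide_right_mono) (auto simp: diff_divide_distrib)
    then show "kern 0.21 0 s \<le> (1 / sqrt (1 - s\<^sup>2) - c * (1 / ((1 - s) * sqrt (1 - s\<^sup>2)))) / (2 * pi)"
      by (simp add: kern_def z_def mult.commute)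
  qed
  also have "\<dots> = (arcsin r - c * sqrt ((1 + r) / (1 - r))) / (2 * pi) - (arcsin 0 - c * sqrt ((1 + 0) / (1 - 0))) / (2 * pi)"
  proof (rule integral_real_FTC[OF r(1)])
    fix s assume s: "0 \<le> s" "s \<le> r"
    then have s': "0 \<le> s" "s < 1" using r by auto
    have "(arcsin has_real_derivative inverse (sqrt (1 - s\<^sup>2))) (at s)"
      using s' by (intro DERIV_arcsin) auto
    from DERIV_cdivide[OF DERIV_diff[OF DERIV_subset[OF this] DERIV_cmult[OF sqrt_quot_deriv(2)[OF s']]], of "{0..r}" c "2 * pi"]
    show "((\<lambda>s. (arcsin s - c * sqrt ((1 + s) / (1 - s))) / (2 * pi)) has_real_derivative
        (1 / sqrt (1 - s\<^sup>2) - c * (1 / ((1 - s) * sqrt (1 - s\<^sup>2)))) / (2 * pi)) (at s within {0..r})"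
      by (simp add: inverse_eq_divide)
  qed
  also have "arcsin r = pi / 4"
  proof -
    have "r = sin (pi / 4)"
      by (simp add: r_def sin_45 real_sqrt_divide real_div_sqrt field_simps)
    then show ?thesis
      using arcsin_sin[of "pi / 4"] by simp
  qed
  finally have "JJ 0.21 0 r \<le> 1 / 8 - c * (sqrt ((1 + r) / (1 - r)) - 1) / (2 * pi)"
    by (simp add: JJ_def field_simps)
  moreover have "2.4 \<le> sqrt ((1 + r) / (1 - r))"
    using rb by (intro real_le_rsqrt) (simp add: le_divide_eq power2_eq_square)
  then have "c * 1.4 / (2 * pi) \<le> c * (sqrt ((1 + r) / (1 - r)) - 1) / (2 * pi)"
    by (intro divide_right_mono mult_left_mono) (auto simp: c_def)
  moreover have "c * 1.4 / (2 * 3.15) \<le> c * 1.4 / (2 * pi)"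
    using pi_approx by (intro divide_left_mono) (auto simp: c_def)
  moreover have "0.1716 \<le> r * (sd 0.21)\<^sup>2"
  proof -
    have "Psi 0.21 \<le> 0.21 / sqrt (2 * pi)"
      by (rule Psi_le_linear) simp
    also have "\<dots> \<le> 0.21 / 2.5066282"
      using sqrt_2pi_bounds by (intro divide_left_mono) auto
    finally have "Psi 0.21 \<le> 0.0838" by simp
    then have "(Psi 0.21)\<^sup>2 \<le> 0.0838\<^sup>2"
      using Psi_nonneg[of "0.21"] by (intro power_mono) auto
    then have "0.2429 \<le> (sd 0.21)\<^sup>2"
      unfolding sd_sq by (simp add: power2_eq_square)
    then have "0.7071 * 0.2429 \<le> r * (sd 0.21)\<^sup>2"
      using rb by (intro mult_mono) auto
    then show ?thesis by simp
  qed
  ultimately show ?thesis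
    unfolding r_def[symmetric] by (simp add: c_def power2_eq_square)
qed

section \<open>The boundary curve\<close>

text \<open>Along the boundary curve threshold and correlation move together, so a total derivative
  is needed. It follows from the partial ones by continuity of \<open>kern\<close>, the partial
  derivative in the correlation, on an open strip.\<close>

lemma JJ_deriv_both:
  assumes r: "(r has_real_derivative r') (at t)" "0 < r t" "r t < 1"
  shows "((\<lambda>t. JJ t 0 (r t)) has_real_derivative
      - 2 * phi t * (Psi (t * sqrt ((1 + r t) / (1 - r t))) - Psi t) + kern t 0 (r t) * r') (at t)"
proof -
  let ?Y = "{0<..<1::real}"
  define fx where "fx = - 2 * phi t * (Psi (t * sqrt ((1 + r t) / (1 - r t))) - Psi t)"
  have "((\<lambda>(x, y). JJ x 0 y) has_derivative
      (\<lambda>(tx, ty). fx * tx + blinfun_mult_right (kern t 0 (r t)) ty)) (at (t, r t) within UNIV \<times> ?Y)"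
  proof (rule has_derivative_partialsI[where fy = "\<lambda>x y. blinfun_mult_right (kern x 0 y)"])
    show "((\<lambda>x. JJ x 0 (r t)) has_derivative (*) fx) (at t)"
      unfolding fx_def using JJ_deriv_left[of "r t" t] r by (simp add: has_field_derivative_def)
    show "((\<lambda>y. JJ x 0 y) has_derivative blinfun_apply (blinfun_mult_right (kern x 0 y))) (at y within ?Y)"
      if "y \<in> ?Y" for x y
      using that JJ_deriv_corr[of y x 0] by (auto simp: has_field_derivative_def intro: has_derivative_at_withinI)
    have "continuous_on (UNIV \<times> ?Y) (\<lambda>z. blinfun_mult_right (kern (fst z) 0 (snd z)))"
      by (intro bounded_linear.continuous_on[OF bounded_linear_blinfun_mult_right] continuous_on_kern continuous_intros)
        auto
    then show "continuous (at (t, r t) within UNIV \<times> ?Y) (\<lambda>(x, y). blinfun_mult_right (kern x 0 y))"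
      using r by (simp add: continuous_on_eq_continuous_within split_beta')
  qed (use r in auto)
  moreover have "at (t, r t) within UNIV \<times> ?Y = at (t, r t)"
    using r by (intro at_within_open open_Times) auto
  ultimately have "((\<lambda>(x, y). JJ x 0 y) has_derivative (\<lambda>(tx, ty). fx * tx + kern t 0 (r t) * ty)) (at (t, r t))"
    by (simp only: blinfun_mult_right.rep_eq)
  moreover have "((\<lambda>t. (t, r t)) has_derivative (\<lambda>d. (d, r' * d))) (at t)"
    using r(1) by (auto intro!: derivative_eq_intros simp: has_field_derivative_def)
  ultimately have "((\<lambda>(x, y). JJ x 0 y) \<circ> (\<lambda>t. (t, r t)) has_derivative
      (\<lambda>(tx, ty). fx * tx + kern t 0 (r t) * ty) \<circ> (\<lambda>d. (d, r' * d))) (at t)"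
    by (intro diff_chain_at)
  moreover have "(\<lambda>(tx, ty). fx * tx + kern t 0 (r t) * ty) \<circ> (\<lambda>d. (d, r' * d)) = (*) (fx + kern t 0 (r t) * r')"
    by (simp add: fun_eq_iff algebra_simps)
  ultimately have "((\<lambda>t. JJ t 0 (r t)) has_derivative (*) (fx + kern t 0 (r t) * r')) (at t)"
    by (simp add: o_def)
  then show ?thesis
    unfolding has_field_derivative_def fx_def .
qed

text \<open>With \<open>b = 2 * Psi t\<close>, minus the correlation of the configuration
  \<open>(b, b, 2 * b - 1)\<close>, for which \<open>b12 - b1 * b2 = - (1 - b)^2\<close>.\<close>

definition curve_corr :: "real \<Rightarrow> real" where
  "curve_corr t = (1 - 2 * Psi t) / (1 + 2 * Psi t)"

text \<open>\<open>- f\<close> on the curve: there \<open>curve_corr t * (sd t)^2\<close> simplifies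
  to \<open>(1 / 2 - Psi t)^2\<close>.\<close>

definition curve_loss :: "real \<Rightarrow> real" where
  "curve_loss t = (1 / 2 - Psi t)\<^sup>2 - JJ t 0 (curve_corr t)"

text \<open>Logarithm of the quotient of the two competing terms in the derivative of
  \<open>curve_loss\<close>: the tail \<open>1 / 2 - Psi u\<close> over
  \<open>phi t * phi u / (sqrt b * (1 + b))\<close>. Taking the logarithm turns a product into a sum
  that can be differentiated and estimated term by term.\<close>

definition curve_crit :: "real \<Rightarrow> real" where
  "curve_crit t = ln (1 / 2 - Psi (t / sqrt (2 * Psi t))) + ln (2 * Psi t) / 2 + ln (1 + 2 * Psi t)
    + (t\<^sup>2 + (t / sqrt (2 * Psi t))\<^sup>2) / 2 + ln (2 * pi)"

lemma curve_corr_bounds: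
  assumes "0 < t"
  shows "0 < curve_corr t" "curve_corr t < 1"
  using Psi_pos[OF assms] Psi_less_half[of t] by (auto simp: curve_corr_def)

text \<open>Since \<open>(1 + r) / (1 - r) = 1 / b\<close> for \<open>r = curve_corr t\<close>, the
  scaled threshold is \<open>u\<close>. The \<open>Psi t\<close> terms from the square and from
  \<open>JJ\<close> cancel, leaving the tail at \<open>u\<close> against the effect of the moving
  correlation.\<close>

lemma curve_loss_deriv:
  assumes t: "0 < t"
  defines "b \<equiv> 2 * Psi t"
  defines "u \<equiv> t / sqrt b"
  shows "(curve_loss has_real_derivative
    2 * phi t * (phi t * phi u / (sqrt b * (1 + b)) - (1 / 2 - Psi u))) (at t)"
proof -
  have b: "0 < b" "b < 1" using Psi_pos[OF t] Psi_less_half[of t] by (auto simp: b_def)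
  have r: "curve_corr t = (1 - b) / (1 + b)"
    by (simp add: curve_corr_def b_def)
  have "1 + curve_corr t = 2 / (1 + b)" and r1: "1 - curve_corr t = 2 * b / (1 + b)"
    using b by (simp_all add: r field_simps)
  then have k: "(1 + curve_corr t) / (1 - curve_corr t) = 1 / b"
  proof -
    have "(2 / a) / (2 * b / a) = 1 / b" if "0 < a" for a
      using b that by (simp add: field_simps)
    from this[of "1 + b"] show ?thesis
      using b unfolding \<open>1 + curve_corr t = 2 / (1 + b)\<close> r1 by simp
  qed
  have "1 - (curve_corr t)\<^sup>2 = (1 + curve_corr t) * (1 - curve_corr t)"
    by (simp add: power2_eq_square algebra_simps)
  also have "\<dots> = (2 * sqrt b / (1 + b))\<^sup>2"
    using b r1 \<open>1 + curve_corr t = 2 / (1 + b)\<close> by (simp add: power_divide power_mult_distrib) (simp add: power2_eq_square)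
  finally have sq: "sqrt (1 - (curve_corr t)\<^sup>2) = 2 * sqrt b / (1 + b)"
    using b by simp
  have "t\<^sup>2 / (1 - curve_corr t) = (t\<^sup>2 + u\<^sup>2) / 2"
    using b unfolding r1 u_def by (simp add: power_divide field_simps)
  then have kern: "kern t 0 (curve_corr t) = phi t * phi u * (1 + b) / (2 * sqrt b)"
    unfolding phi_mult kern_def sq by simp
  have "(curve_corr has_real_derivative - 4 * phi t / (1 + b)\<^sup>2) (at t)"
    unfolding curve_corr_def[abs_def] b_def using b
    by (auto intro!: derivative_eq_intros simp: b_def field_simps power2_eq_square)
  note J = JJ_deriv_both[OF this curve_corr_bounds[OF t], unfolded k kern]
  have "((\<lambda>t. (1 / 2 - Psi t)\<^sup>2) has_real_derivative - 2 * (1 / 2 - Psi t) * phi t) (at t)"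
    by (auto intro!: derivative_eq_intros simp: algebra_simps)
  from DERIV_diff[OF this J]
  have "(curve_loss has_real_derivative - 2 * (1 / 2 - Psi t) * phi t -
      (- 2 * phi t * (Psi (t * sqrt (1 / b)) - Psi t) + phi t * phi u * (1 + b) / (2 * sqrt b) * (- 4 * phi t / (1 + b)\<^sup>2)))
      (at t)"
    unfolding curve_loss_def[abs_def] .
  also have "t * sqrt (1 / b) = u"
    by (simp add: u_def real_sqrt_divide)
  also have "phi t * phi u * (1 + b) / (2 * sqrt b) * (- 4 * phi t / (1 + b)\<^sup>2)
      = - (2 * phi t * (phi t * phi u / (sqrt b * (1 + b))))"
  proof -
    have "a * m / (2 * s) * (- 4 * p / m\<^sup>2) = - (2 * p * (a / (s * m)))" if "0 < m" for a m s p :: real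
      using that by (simp add: power2_eq_square)
    then show ?thesis using b by simp
  qed
  finally show ?thesis
    by (simp add: algebra_simps)
qed

lemma curve_crit_eq:
  assumes t: "0 < t"
  defines "b \<equiv> 2 * Psi t"
  defines "u \<equiv> t / sqrt b"
  shows "curve_crit t = ln ((1 / 2 - Psi u) * (2 * pi * (sqrt b * (1 + b)) * exp ((t\<^sup>2 + u\<^sup>2) / 2)))"
proof -
  have "0 < b" using Psi_pos[OF t] by (simp add: b_def)
  moreover have "0 < 1 / 2 - Psi u" using Psi_less_half[of u] by simp
  ultimately show ?thesis
    by (simp add: curve_crit_def b_def[symmetric] u_def[symmetric] ln_mult_pos ln_sqrt)
qed

lemma curve_loss_deriv_sign:
  assumes t: "0 < t"
  obtains d where "(curve_loss has_real_derivative d) (at t)"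
    and "curve_crit t \<le> 0 \<Longrightarrow> 0 \<le> d" "0 \<le> curve_crit t \<Longrightarrow> d \<le> 0"
proof -
  define b u where "b = 2 * Psi t" and "u = t / sqrt b"
  define c where "c = 2 * pi * (sqrt b * (1 + b)) * exp ((t\<^sup>2 + u\<^sup>2) / 2)"
  have b: "0 < b" using Psi_pos[OF t] by (simp add: b_def)
  then have c: "0 < c" by (simp add: c_def)
  have u: "0 < 1 / 2 - Psi u" using Psi_less_half[of u] by simp
  have "curve_crit t = ln ((1 / 2 - Psi u) * c)"
    using curve_crit_eq[OF t] by (simp add: b_def u_def c_def)
  moreover have "phi t * phi u / (sqrt b * (1 + b)) - (1 / 2 - Psi u) = (1 - (1 / 2 - Psi u) * c) / c"
  proof -
    have "phi t * phi u / (sqrt b * (1 + b)) = 1 / c"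
      unfolding phi_mult c_def using b by (simp add: exp_minus field_simps)
    then show ?thesis using c by (simp add: diff_divide_distrib)
  qed
  ultimately show ?thesis
    using that[OF curve_loss_deriv[OF t]] c u phi_pos[of t]
    by (simp add: b_def[symmetric] u_def[symmetric] zero_le_mult_iff mult_le_0_iff zero_le_divide_iff
        divide_le_0_iff ln_le_zero_iff ln_ge_zero_iff)
qed

text \<open>The only negative term of the derivative \<open>d\<close> is the hazard rate
  \<open>phi u / (1 / 2 - Psi u)\<close> times \<open>u'\<close>. Bounding the rate by
  \<open>u + 3 / 2\<close> lets \<open>u * u'\<close> cancel; the rest,
  \<open>3 / 2 * u' <= 27 / 32 / z\<close>, is absorbed by \<open>p / b + 2 * p / (1 + b)\<close>.
  The constants come from \<open>b <= 3 / 8\<close> and its consequence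
  \<open>v <= 1 / 2\<close>.\<close>

lemma curve_crit_mono:
  assumes s: "0 < s" "s \<le> t" and t: "2 * Psi t \<le> 3 / 8"
  shows "curve_crit s \<le> curve_crit t"
proof (rule DERIV_nonneg_imp_nondecreasing[OF s(2)])
  fix v assume v: "s \<le> v" "v \<le> t"
  define p where "p = phi v"
  define b z u where "b = 2 * Psi v" and "z = sqrt b" and "u = v / z"
  have v0: "0 < v" using v s by simp
  have b: "0 < b" "b \<le> 3 / 8"
    using Psi_pos[OF v0] Psi_mono[OF v(2)] t by (auto simp: b_def)
  have z: "0 < z" "z\<^sup>2 = b" using b by (auto simp: z_def)
  have q: "1 / sqrt (2 * pi) \<le> 1 / 2.5066282" "1 / 2.5066283 \<le> 1 / sqrt (2 * pi)"
    using sqrt_2pi_bounds by (intro divide_left_mono; simp)+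
  have v1: "v \<le> 1 / 2"
  proof (rule ccontr)
    assume "\<not> v \<le> 1 / 2"
    then have "Psi (1 / 2) \<le> b / 2"
      using Psi_mono[of "1 / 2" v] by (simp add: b_def)
    moreover have "23 / 48 * (1 / 2.5066283) \<le> 23 / 48 * (1 / sqrt (2 * pi))"
      using q by (intro mult_left_mono) auto
    then have "23 / 48 * (1 / 2.5066283) \<le> Psi (1 / 2)"
      using Psi_ge_cubic[of "1 / 2"] by (simp add: power3_eq_cube)
    ultimately show False using b by simp
  qed

  have p_ge: "(1 - v\<^sup>2 / 2) / sqrt (2 * pi) \<le> p"
    unfolding p_def phi_eq using exp_ge_add_one_self[of "- (v\<^sup>2 / 2)"]
    by (intro divide_right_mono) auto
  have vv: "v\<^sup>2 \<le> 1 / 4"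
    using power_mono[OF v1, of 2] v0 by (simp add: power2_eq_square)
  have p0: "0 < p" by (simp add: p_def phi_pos)
  have p_ge': "348 / 1000 \<le> p"
  proof -
    have "7 / 8 * (1 / 2.5066283) \<le> (1 - v\<^sup>2 / 2) * (1 / sqrt (2 * pi))"
      using vv q by (intro mult_mono) auto
    also have "\<dots> = (1 - v\<^sup>2 / 2) / sqrt (2 * pi)" by simp
    also note p_ge
    finally show ?thesis by simp
  qed
  have b_le: "b * sqrt (2 * pi) \<le> 2 * v"
    using Psi_le_linear[of v] v0 by (simp add: b_def field_simps)
  have vpb: "7 / 16 \<le> v * p / b"
  proof -
    have "7 / 8 \<le> 1 - v\<^sup>2 / 2" using vv by simp
    also have "\<dots> \<le> p * sqrt (2 * pi)"
      using p_ge by (simp add: divide_le_eq)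
    finally have "b * (7 / 8) \<le> b * (p * sqrt (2 * pi))"
      using b by (intro mult_left_mono) auto
    also have "\<dots> \<le> 2 * v * p"
      using mult_right_mono[OF b_le, of p] p0 by (simp add: mult_ac)
    finally show ?thesis using b by (simp add: field_simps)
  qed
  have u0: "0 < u" using v0 z by (simp add: u_def)
  have uu: "u\<^sup>2 \<le> 0.655"
  proof -
    have "v * (1 - (1 / 2)\<^sup>2 / 6) * (1 / 2.5066283) \<le> v * (1 - (1 / 2)\<^sup>2 / 6) * (1 / sqrt (2 * pi))"
      using q v0 by (intro mult_left_mono) (auto simp: power2_eq_square)
    also have "\<dots> = v * (1 - (1 / 2)\<^sup>2 / 6) / sqrt (2 * pi)" by simp
    also have "\<dots> \<le> Psi v"
      using v0 v1 by (intro Psi_ge_linear) auto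
    finally have "v * (1 - (1 / 2)\<^sup>2 / 6) * (1 / 2.5066283) \<le> Psi v" .
    then have "v * (7645 / 10000) \<le> b"
      unfolding b_def using v0 by (simp add: power2_eq_square)
    from mult_left_mono[OF this, of v] have "v\<^sup>2 * (7645 / 10000) \<le> v * b"
      using v0 by (simp add: power2_eq_square)
    also have "\<dots> \<le> 1 / 2 * b"
      using v1 b by (intro mult_right_mono) auto
    finally have "v\<^sup>2 \<le> b * 0.655" using b by simp
    then show ?thesis
      using b by (simp add: u_def power_divide z(2) divide_le_eq mult.commute)
  qed
  have u1: "u \<le> 0.81"
    using uu by (intro power2_le_imp_le[of u "0.81"]) (auto simp: power2_eq_square)
  \<comment> \<open>For \<open>u <= 0.81\<close> crude linear bounds suffice: \<open>0.399\<close>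
    exceeds \<open>1 / sqrt (2 * pi)\<close>, which bounds both \<open>phi\<close> and the slope of
    \<open>Psi\<close>.\<close>
  have mills: "phi u \<le> (u + 3 / 2) * (1 / 2 - Psi u)"
  proof -
    have "phi u \<le> 1 / sqrt (2 * pi)"
      unfolding phi_eq by (simp add: divide_right_mono)
    then have "phi u \<le> 0.399" using q by simp
    also have "0.399 \<le> 3 / 4 - 985 / 10000 * u - 399 / 1000 * u\<^sup>2"
      using uu u1 by simp
    also have "\<dots> = (u + 3 / 2) * (1 / 2 - 0.399 * u)"
      by (simp add: field_simps power2_eq_square)
    also have "\<dots> \<le> (u + 3 / 2) * (1 / 2 - Psi u)"
    proof -
      have "Psi u \<le> u * (1 / sqrt (2 * pi))"
        using Psi_le_linear[of u] u0 by simp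
      also have "\<dots> \<le> u * 0.399"
        using q u0 by (intro mult_left_mono) auto
      finally have "1 / 2 - 0.399 * u \<le> 1 / 2 - Psi u"
        by (simp only: mult.commute[of u] diff_left_mono)
      then show ?thesis
        by (rule mult_left_mono) (use u0 in simp)
    qed
    finally show ?thesis .
  qed
  have hu: "0 < 1 / 2 - Psi u" using Psi_less_half[of u] by simp
  define u' where "u' = (1 - v * p / b) / z"
  define d where "d = - phi u * u' / (1 / 2 - Psi u) + p / b + 2 * p / (1 + b) + v + u * u'"
  have b': "((\<lambda>v. 2 * Psi v) has_real_derivative 2 * p) (at v)"
    unfolding p_def by (auto intro!: derivative_eq_intros)
  have z': "((\<lambda>v. sqrt (2 * Psi v)) has_real_derivative p / z) (at v)"
    using DERIV_chain2[OF DERIV_real_sqrt b'] b unfolding z_def b_def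
    by (simp add: inverse_eq_divide)
  have "((\<lambda>v. v / sqrt (2 * Psi v)) has_real_derivative (1 * z - v * (p / z)) / (z * z)) (at v)"
    using DERIV_divide[OF DERIV_ident z'] z by (simp add: z_def b_def)
  moreover have "(1 * z - v * (p / z)) / (z * z) = u'"
    using z by (simp add: u'_def z(2)[symmetric] power2_eq_square field_simps)
  ultimately have du: "((\<lambda>v. v / sqrt (2 * Psi v)) has_real_derivative u') (at v)"
    by simp
  have "(curve_crit has_real_derivative d) (at v)"
  proof -
    have 1: "((\<lambda>v. ln (1 / 2 - Psi (v / sqrt (2 * Psi v)))) has_real_derivative
        inverse (1 / 2 - Psi u) * (0 - phi u * u')) (at v)"
      using hu DERIV_chain2[OF DERIV_ln DERIV_diff[OF DERIV_const Psi_deriv[OF du]]]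
      by (simp add: u_def z_def b_def)
    have 2: "((\<lambda>v. ln (2 * Psi v) / 2) has_real_derivative inverse b * (2 * p) / 2) (at v)"
      using b DERIV_cdivide[OF DERIV_chain2[OF DERIV_ln b']] by (simp add: b_def)
    have 3: "((\<lambda>v. ln (1 + 2 * Psi v)) has_real_derivative inverse (1 + b) * (0 + 2 * p)) (at v)"
      using b DERIV_chain2[OF DERIV_ln DERIV_add[OF DERIV_const b']] by (simp add: b_def)
    have 4: "((\<lambda>v. (v\<^sup>2 + (v / sqrt (2 * Psi v))\<^sup>2) / 2) has_real_derivative (2 * v + 2 * u * u') / 2) (at v)"
    proof -
      have "((\<lambda>v. (v\<^sup>2 + (v / sqrt (2 * Psi v))\<^sup>2) / 2) has_real_derivative
          (of_nat 2 * (1 * v ^ (2 - Suc 0)) + of_nat 2 * (u' * (v / sqrt (2 * Psi v)) ^ (2 - Suc 0))) / 2) (at v)"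
        by (intro DERIV_cdivide DERIV_add DERIV_power DERIV_ident du)
      then show ?thesis
        by (simp add: u_def z_def b_def mult_ac)
    qed
    have "(curve_crit has_real_derivative inverse (1 / 2 - Psi u) * (0 - phi u * u') + inverse b * (2 * p) / 2
        + inverse (1 + b) * (0 + 2 * p) + (2 * v + 2 * u * u') / 2 + 0) (at v)"
      unfolding curve_crit_def[abs_def] by (intro DERIV_add 1 2 3 4 DERIV_const)
    moreover have "inverse (1 / 2 - Psi u) * (0 - phi u * u') + inverse b * (2 * p) / 2
        + inverse (1 + b) * (0 + 2 * p) + (2 * v + 2 * u * u') / 2 + 0 = d"
      unfolding d_def by (simp only: divide_inverse) simp
    ultimately show ?thesis by (simp only:)
  qed
  moreover have "0 \<le> d"
  proof -
    have "v * p \<le> b"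
    proof -
      have "p * v \<le> Psi v"
      proof -
        have "(\<lambda>w. Psi w - p * w) 0 \<le> (\<lambda>w. Psi w - p * w) v"
        proof (rule DERIV_nonneg_imp_nondecreasing[OF less_imp_le[OF v0]])
          fix w assume w: "0 \<le> w" "w \<le> v"
          have "((\<lambda>w. Psi w - p * w) has_real_derivative phi w - p) (at w)"
            by (auto intro!: derivative_eq_intros)
          moreover have "p \<le> phi w"
            unfolding p_def using w by (intro phi_antimono) auto
          ultimately show "\<exists>y. ((\<lambda>w. Psi w - p * w) has_real_derivative y) (at w) \<and> 0 \<le> y"
            by (intro exI conjI) auto
        qed
        then show ?thesis by simp
      qed
      then show ?thesis using Psi_nonneg[of v] v0 by (simp add: b_def mult.commute)
    qed
    then have u'0: "0 \<le> u'"
      using b z by (simp add: u'_def)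
    have u'1: "u' \<le> 9 / 16 / z"
      unfolding u'_def using vpb z by (intro divide_right_mono) auto
    have "phi u / (1 / 2 - Psi u) \<le> u + 3 / 2"
      using mills hu by (simp add: divide_le_eq)
    from mult_right_mono[OF this u'0]
    have 1: "phi u * u' / (1 / 2 - Psi u) \<le> u * u' + 3 / 2 * u'"
      by (simp add: algebra_simps)
    have 2: "27 / 32 / z \<le> p / b + 2 * p / (1 + b)"
    proof -
      \<comment> \<open>The square is centred near the minimum of
        \<open>348 / 1000 * (1 + 3 * z^2) - 297 / 256 * z\<close>. Here \<open>297 / 256\<close> is
        \<open>27 / 32 * 11 / 8\<close>, from \<open>1 + b <= 11 / 8\<close>.\<close>
      have "0 \<le> (z - 5 / 9)\<^sup>2" by simp
      then have "10 / 9 * z - 25 / 81 \<le> b"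
        unfolding z(2)[symmetric] by (simp add: power2_eq_square algebra_simps)
      moreover have "z \<le> 1"
        unfolding z_def using b by simp
      ultimately have "297 / 256 * z \<le> 348 / 1000 * (1 + 3 * b)"
        by simp
      also have "\<dots> \<le> p * (1 + 3 * b)"
        using p_ge' b by (intro mult_right_mono) auto
      finally have "297 / 256 * z \<le> p * (1 + 3 * b)" .
      moreover have "27 / 32 * (1 + b) * z \<le> 297 / 256 * z"
        using b z by (intro mult_right_mono) auto
      ultimately have "27 / 32 * (1 + b) * z \<le> p * (1 + 3 * b)"
        by (rule order_trans[rotated])
      then have "27 / 32 * (1 + b) * z / (b * (1 + b)) \<le> p * (1 + 3 * b) / (b * (1 + b))"
        using b by (intro divide_right_mono) auto
      moreover have "27 / 32 * (1 + b) * z / (b * (1 + b)) = 27 / 32 / z"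
      proof -
        have "27 / 32 * m * z / (z\<^sup>2 * m) = 27 / 32 / z" if "0 < m" for m
          using that z(1) by (simp add: power2_eq_square)
        from this[of "1 + b"] show ?thesis
          using b by (simp add: z(2))
      qed
      moreover have "p * (1 + 3 * b) / (b * (1 + b)) = p / b + 2 * p / (1 + b)"
        using b by (simp add: field_simps)
      ultimately show ?thesis by simp
    qed
    show ?thesis
      unfolding d_def using 1 2 u'1 v0 by simp
  qed
  ultimately show "\<exists>d. (curve_crit has_real_derivative d) (at v) \<and> 0 \<le> d" by blast
qed

section \<open>Numerical location of the maximum\<close>

lemma Psi_lowerI:
  assumes "0 \<le> x" "odd n" "0 \<le> p" "p * 2.5066283 \<le> PsiT n x"
  shows "p \<le> Psi x"
proof -
  have "p * sqrt (2 * pi) \<le> p * 2.5066283"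
    using assms(3) sqrt_2pi_bounds by (intro mult_left_mono) auto
  then have "p \<le> PsiT n x / sqrt (2 * pi)"
    using assms(4) by (simp add: le_divide_eq)
  then show ?thesis
    using PsiT_bounds[OF assms(1), of n] assms(2) by simp
qed

lemma Psi_upperI:
  assumes "0 \<le> x" "even n" "0 \<le> p" "PsiT n x \<le> p * 2.5066282"
  shows "Psi x \<le> p"
proof -
  have "p * 2.5066282 \<le> p * sqrt (2 * pi)"
    using assms(3) sqrt_2pi_bounds by (intro mult_left_mono) auto
  then have "PsiT n x / sqrt (2 * pi) \<le> p"
    using assms(4) by (simp add: divide_le_eq)
  then show ?thesis
    using PsiT_bounds[OF assms(1), of n] assms(2) by simp
qed

lemma PsiT_numeral:
  "PsiT 3 x = x - x ^ 3 / 6 + x ^ 5 / 40 - x ^ 7 / 336"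
  "PsiT 4 x = x - x ^ 3 / 6 + x ^ 5 / 40 - x ^ 7 / 336 + x ^ 9 / 3456"
  "PsiT 5 x = x - x ^ 3 / 6 + x ^ 5 / 40 - x ^ 7 / 336 + x ^ 9 / 3456 - x ^ 11 / 42240"
  by (simp_all add: PsiT_def eval_nat_numeral)

lemma expT_numeral:
  "expT 5 z = 1 - z + z ^ 2 / 2 - z ^ 3 / 6 + z ^ 4 / 24 - z ^ 5 / 120"
  "expT 6 z = 1 - z + z ^ 2 / 2 - z ^ 3 / 6 + z ^ 4 / 24 - z ^ 5 / 120 + z ^ 6 / 720"
  by (simp_all add: expT_def eval_nat_numeral)

text \<open>This threshold and that of the next lemma bracket the sign change of
  \<open>curve_crit\<close>; both values of \<open>2 * Psi t\<close> lie within \<open>10^-6\<close>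
  of \<open>0.1489442\<close>. The exponential is moved to the other side, where a Taylor polynomial
  of odd degree bounds it from below and one of even degree from above.\<close>

lemma curve_crit_le_0:
  defines "t \<equiv> 0.18777045"
  shows "0.148943397 \<le> 2 * Psi t" and "curve_crit t \<le> 0"
proof -
  define b z u where "b = 2 * Psi t" and "z = sqrt b" and "u = t / z"
  have t: "0 < t" by (simp add: t_def)
  have "0.0744716985 \<le> Psi t"
    by (rule Psi_lowerI[of _ 3]) (simp_all add: t_def PsiT_numeral power_divide)
  moreover have "Psi t \<le> 0.074471702"
    by (rule Psi_upperI[of _ 4]) (simp_all add: t_def PsiT_numeral power_divide)
  ultimately have b: "0.148943397 \<le> b" "b \<le> 0.148943404"
    by (simp_all add: b_def)
  then show "0.148943397 \<le> 2 * Psi t"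
    by (simp add: b_def)
  have z: "0.385931855 \<le> z" "z \<le> 0.385931865"
    unfolding z_def by (rule real_le_rsqrt real_le_lsqrt; use b in \<open>simp add: power2_eq_square\<close>)+
  have "t / 0.385931865 \<le> u" "u \<le> t / 0.385931855"
    unfolding u_def using z t by (intro divide_left_mono; simp)+
  then have u: "0.486537824 \<le> u" "u \<le> 0.486537838"
    by (simp_all add: t_def)
  have "0.18670705 \<le> Psi 0.486537824"
    by (rule Psi_lowerI[of _ 5]) (simp_all add: PsiT_numeral power_divide)
  then have "0.18670705 \<le> Psi u"
    using Psi_mono[OF u(1)] by simp
  then have "(1 / 2 - Psi u) * (2 * pi * (z * (1 + b)))
      \<le> 0.31329295 * (2 * 3.1415926535899 * (0.385931865 * (1 + 0.148943404)))"
    using b z pi_approx(2) Psi_less_half[of u] by (intro mult_mono) auto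
  also have "\<dots> \<le> expT 5 0.135988406"
    by (simp add: expT_numeral power_divide)
  also have "\<dots> \<le> exp (- 0.135988406)"
    using expT_bounds[of "0.135988406" 5] by simp
  also have "\<dots> \<le> exp (- ((t\<^sup>2 + u\<^sup>2) / 2))"
  proof -
    have "u\<^sup>2 \<le> 0.486537838\<^sup>2"
      using u by (intro power_mono) auto
    then show ?thesis by (simp add: t_def power2_eq_square)
  qed
  finally have "(1 / 2 - Psi u) * (2 * pi * (z * (1 + b))) * exp ((t\<^sup>2 + u\<^sup>2) / 2) \<le> 1"
    by (simp add: exp_minus field_simps)
  moreover have "0 < (1 / 2 - Psi u) * (2 * pi * (z * (1 + b)) * exp ((t\<^sup>2 + u\<^sup>2) / 2))"
    using b z Psi_less_half[of u] by simp
  ultimately show "curve_crit t \<le> 0"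
    using curve_crit_eq[OF t] by (simp add: b_def z_def u_def mult.assoc)
qed

lemma curve_crit_ge_0:
  defines "t \<equiv> 0.18777249"
  shows "2 * Psi t \<le> 0.148945003" and "0 \<le> curve_crit t"
proof -
  define b z u where "b = 2 * Psi t" and "z = sqrt b" and "u = t / z"
  have t: "0 < t" by (simp add: t_def)
  have "0.074472498 \<le> Psi t"
    by (rule Psi_lowerI[of _ 3]) (simp_all add: t_def PsiT_numeral power_divide)
  moreover have "Psi t \<le> 0.0744725015"
    by (rule Psi_upperI[of _ 4]) (simp_all add: t_def PsiT_numeral power_divide)
  ultimately have b: "0.148944996 \<le> b" "b \<le> 0.148945003"
    by (simp_all add: b_def)
  then show "2 * Psi t \<le> 0.148945003"
    by (simp add: b_def)
  have z: "0.385933926 \<le> z" "z \<le> 0.385933937"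
    unfolding z_def by (rule real_le_rsqrt real_le_lsqrt; use b in \<open>simp add: power2_eq_square\<close>)+
  have "t / 0.385933937 \<le> u" "u \<le> t / 0.385933926"
    unfolding u_def using z t by (intro divide_left_mono; simp)+
  then have u: "0.486540498 \<le> u" "u \<le> 0.486540513"
    by (simp_all add: t_def)
  have "Psi 0.486540513 \<le> 0.186708015"
    by (rule Psi_upperI[of _ 4]) (simp_all add: PsiT_numeral power_divide)
  then have Pu: "Psi u \<le> 0.186708015"
    using Psi_mono[OF u(2)] by simp
  have "exp (- ((t\<^sup>2 + u\<^sup>2) / 2)) \<le> exp (- 0.135990081)"
  proof -
    have "0.486540498\<^sup>2 \<le> u\<^sup>2"
      using u by (intro power_mono) auto
    then show ?thesis by (simp add: t_def power2_eq_square)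
  qed
  also have "\<dots> \<le> expT 6 0.135990081"
    using expT_bounds[of "0.135990081" 6] by simp
  also have "\<dots> \<le> 0.313291985 * (2 * 3.141592653588 * (0.385933926 * (1 + 0.148944996)))"
    by (simp add: expT_numeral power_divide)
  also have "\<dots> \<le> (1 / 2 - Psi u) * (2 * pi * (z * (1 + b)))"
    using b z pi_approx(1) Pu by (intro mult_mono) auto
  finally have "1 \<le> (1 / 2 - Psi u) * (2 * pi * (z * (1 + b))) * exp ((t\<^sup>2 + u\<^sup>2) / 2)"
    by (simp add: exp_minus field_simps)
  then show "0 \<le> curve_crit t"
    using curve_crit_eq[OF t] by (simp add: b_def z_def u_def mult.assoc)
qed

text \<open>No zero of \<open>curve_crit\<close> has to be extracted: compactness gives a maximiser
  inside the bracket, and the sign of \<open>curve_crit\<close> makes the loss increase up to the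
  bracket and decrease after it.\<close>

lemma curve_loss_maximum:
  obtains t where "0 < t" "0.148943397 \<le> 2 * Psi t" "2 * Psi t \<le> 0.148945003"
    and "\<And>s. 0 < s \<Longrightarrow> 2 * Psi s \<le> 3 / 8 \<Longrightarrow> curve_loss s \<le> curve_loss t"
proof -
  define lo hi :: real where "lo = 0.18777045" and "hi = 0.18777249"
  note lo = curve_crit_le_0[folded lo_def] and hi = curve_crit_ge_0[folded hi_def]
  have lohi: "0 < lo" "lo \<le> hi" by (simp_all add: lo_def hi_def)
  have "continuous_on {lo..hi} curve_loss"
  proof (intro continuous_at_imp_continuous_on ballI)
    fix t assume "t \<in> {lo..hi}"
    then show "isCont curve_loss t"
      using curve_loss_deriv[of t] lohi by (intro DERIV_isCont) auto
  qed
  then obtain t where t: "t \<in> {lo..hi}" "\<And>s. s \<in> {lo..hi} \<Longrightarrow> curve_loss s \<le> curve_loss t"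
    using continuous_attains_sup[of "{lo..hi}" curve_loss] lohi by auto
  have "curve_loss s \<le> curve_loss t" if s: "0 < s" "2 * Psi s \<le> 3 / 8" for s
  proof -
    consider "s < lo" | "s \<in> {lo..hi}" | "hi < s" by fastforce
    then show ?thesis
    proof cases
      case 1
      have "curve_loss s \<le> curve_loss lo"
      proof (rule DERIV_nonneg_imp_nondecreasing[OF less_imp_le[OF 1]])
        fix v assume v: "s \<le> v" "v \<le> lo"
        have "0 < v" using s v by simp
        obtain d where d: "(curve_loss has_real_derivative d) (at v)" "curve_crit v \<le> 0 \<Longrightarrow> 0 \<le> d"
          using curve_loss_deriv_sign[OF \<open>0 < v\<close>] by blast
        have "2 * Psi lo \<le> 3 / 8"
          using hi(1) Psi_mono[OF lohi(2)] by simp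
        then have "curve_crit v \<le> curve_crit lo"
          by (rule curve_crit_mono[OF \<open>0 < v\<close> v(2)])
        then show "\<exists>d. (curve_loss has_real_derivative d) (at v) \<and> 0 \<le> d"
          using d lo(2) by auto
      qed
      also have "\<dots> \<le> curve_loss t"
        using lohi by (intro t) auto
      finally show ?thesis .
    next
      case 3
      have "curve_loss s \<le> curve_loss hi"
      proof (rule DERIV_nonpos_imp_nonincreasing[OF less_imp_le[OF 3]])
        fix v assume v: "hi \<le> v" "v \<le> s"
        have "0 < v" using lohi v by simp
        obtain d where d: "(curve_loss has_real_derivative d) (at v)" "0 \<le> curve_crit v \<Longrightarrow> d \<le> 0"
          using curve_loss_deriv_sign[OF \<open>0 < v\<close>] by blast
        have "2 * Psi v \<le> 3 / 8"
          using s(2) Psi_mono[OF v(2)] by simp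
        then have "curve_crit hi \<le> curve_crit v"
          using lohi v by (intro curve_crit_mono) auto
        then show "\<exists>d. (curve_loss has_real_derivative d) (at v) \<and> d \<le> 0"
          using d hi(2) by auto
      qed
      also have "\<dots> \<le> curve_loss t"
        using lohi by (intro t) auto
      finally show ?thesis .
    qed (rule t)
  qed
  moreover have "0 < t" "0.148943397 \<le> 2 * Psi t" "2 * Psi t \<le> 0.148945003"
    using t(1) lohi lo(1) hi(1) Psi_mono[of lo t] Psi_mono[of t hi] by auto
  ultimately show ?thesis using that by blast
qed

section \<open>Configurations\<close>

text \<open>The witness is the boundary threshold for this \<open>r\<close>, where
  \<open>2 * Psi t = (1 - r) / (1 + r)\<close>; the condition \<open>5 / 11 <= r\<close> makes this
  value at most \<open>3 / 8\<close>.\<close>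

lemma diagonal_loss_le_curve_loss:
  assumes r: "0 \<le> r" "r < 1" "5 / 11 \<le> r" and x: "0 \<le> x" "r * (1 / 2 + Psi x) \<le> 1 / 2 - Psi x"
  obtains t where "0 < t" "2 * Psi t \<le> 3 / 8" "r * (sd x)\<^sup>2 - JJ x 0 r \<le> curve_loss t"
proof -
  define b where "b = (1 - r) / (1 + r)"
  have b: "0 < b" "b \<le> 3 / 8" using r by (auto simp: b_def divide_le_eq)
  have rb: "r = (1 - b) / (1 + b)"
    using r by (simp add: b_def field_simps)
  obtain t where "Phi t = 1 / 2 + b / 2"
    using b Phi_surj[of "1 / 2 + b / 2"] by auto
  then have t: "2 * Psi t = b" by (simp add: Psi_def)
  then have corr: "curve_corr t = r"
    by (simp add: curve_corr_def rb)
  have "0 < t"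
    using t b Psi_mono[of t 0] by (cases "0 < t") auto
  have "2 * Psi x \<le> b"
    using x(2) r by (simp add: b_def field_simps)
  then have "x \<le> t"
    using t Psi_strict_mono[of t x] by (cases "x \<le> t") auto
  then have "r * (sd x)\<^sup>2 - JJ x 0 r \<le> r * (sd t)\<^sup>2 - JJ t 0 r"
    using diagonal_loss_mono[OF b rb x(1)] t by simp
  also have "r * (sd t)\<^sup>2 = (1 / 2 - Psi t)\<^sup>2"
  proof -
    have "(1 - b) / (1 + b) * (1 / 4 - (b / 2)\<^sup>2) = (1 / 2 - b / 2)\<^sup>2"
      using b by (simp add: field_simps power2_eq_square)
    moreover have "Psi t = b / 2" using t by simp
    ultimately show ?thesis by (simp only: rb sd_sq)
  qed
  finally have "r * (sd x)\<^sup>2 - JJ x 0 r \<le> curve_loss t"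
    by (simp add: curve_loss_def corr)
  then show ?thesis
    using that \<open>0 < t\<close> t b by blast
qed

text \<open>The explicit point \<open>0.21\<close> is feasible for \<open>r = sqrt (1 / 2)\<close>
  but not placed on the curve; monotonicity in \<open>x\<close> carries its loss there.\<close>

lemma curve_loss_maximum_ge:
  assumes tm_max: "\<And>s. 0 < s \<Longrightarrow> 2 * Psi s \<le> 3 / 8 \<Longrightarrow> curve_loss s \<le> curve_loss tm"
  shows "0.055 \<le> curve_loss tm"
proof -
  define r where "r = sqrt (1 / 2 :: real)"
  have r: "0.7071 \<le> r" "r \<le> 0.7072"
    unfolding r_def by (rule real_le_rsqrt real_le_lsqrt; simp add: power2_eq_square)+
  have "Psi 0.21 \<le> 0.0838"
    by (rule Psi_upperI[of _ 4]) (simp_all add: PsiT_numeral power_divide)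
  then have "r * (1 / 2 + Psi 0.21) \<le> 0.7072 * 0.5838"
    using r Psi_nonneg[of "0.21"] by (intro mult_mono) auto
  also have "\<dots> \<le> 1 / 2 - Psi 0.21"
    using \<open>Psi 0.21 \<le> 0.0838\<close> by simp
  finally have "r * (1 / 2 + Psi 0.21) \<le> 1 / 2 - Psi 0.21" .
  then obtain t where "0 < t" "2 * Psi t \<le> 3 / 8" "r * (sd 0.21)\<^sup>2 - JJ 0.21 0 r \<le> curve_loss t"
    using diagonal_loss_le_curve_loss[of r "0.21"] r by auto
  then show ?thesis
    using diagonal_loss_at_0_21 tm_max[of t] by (simp add: r_def)
qed

text \<open>The last hypothesis is the triangle inequality in terms of \<open>r\<close>. Squared, it
  bounds \<open>r^2\<close> by the product of the odds at \<open>u\<close> and \<open>t\<close>;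
  \<open>odds_product_le\<close> passes this to the mean \<open>x\<close>, so the equal-threshold
  point meets the same constraint.\<close>

lemma loss_le_curve_loss_maximum:
  assumes tm_max: "\<And>s. 0 < s \<Longrightarrow> 2 * Psi s \<le> 3 / 8 \<Longrightarrow> curve_loss s \<le> curve_loss tm"
    and r: "0 \<le> r" "r < 1" and ut: "0 \<le> u + t"
    and le: "r * (sd u * sd t) \<le> (1 / 2 - Psi u) * (1 / 2 - Psi t)"
  shows "r * (sd u * sd t) - JJ ((u + t) / 2) ((u - t) / 2) r \<le> curve_loss tm"
proof -
  define x y where "x = (u + t) / 2" and "y = (u - t) / 2"
  have xy: "u = x + y" "t = x - y" by (simp_all add: x_def y_def field_simps)
  have x: "0 \<le> x" using ut by (simp add: x_def)
  have pos: "0 < 1 / 2 - Psi v" "0 < 1 / 2 + Psi v" for v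
    using Psi_less_half[of v] Psi_gt_minus_half[of v] by auto
  have sd2: "(sd v)\<^sup>2 = (1 / 2 - Psi v) * (1 / 2 + Psi v)" for v
    unfolding sd_sq by (simp add: power2_eq_square algebra_simps)
  define A B C D where "A = 1 / 2 - Psi u" and "B = 1 / 2 - Psi t" and "C = 1 / 2 + Psi u" and "D = 1 / 2 + Psi t"
  have "(r * (sd u * sd t))\<^sup>2 \<le> (A * B)\<^sup>2"
    using le r sd_pos[of u] sd_pos[of t] unfolding A_def B_def by (intro power_mono) auto
  then have "(A * B) * (r\<^sup>2 * (C * D)) \<le> (A * B) * (A * B)"
    unfolding power_mult_distrib sd2 A_def B_def C_def D_def by (simp add: power2_eq_square mult_ac)
  then have "r\<^sup>2 * (C * D) \<le> A * B"
    using pos[of u] pos[of t] by (subst (asm) mult_le_cancel_left_pos) (auto simp: A_def B_def)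
  then have "r\<^sup>2 * (C * D) * (1 / 2 + Psi x)\<^sup>2 \<le> A * B * (1 / 2 + Psi x)\<^sup>2"
    by (intro mult_right_mono) auto
  also have "\<dots> \<le> (1 / 2 - Psi x)\<^sup>2 * (C * D)"
    using odds_product_le[OF x, of y] by (simp add: A_def B_def C_def D_def xy)
  finally have "(C * D) * (r * (1 / 2 + Psi x))\<^sup>2 \<le> (C * D) * (1 / 2 - Psi x)\<^sup>2"
    by (simp add: power_mult_distrib mult_ac)
  then have "(r * (1 / 2 + Psi x))\<^sup>2 \<le> (1 / 2 - Psi x)\<^sup>2"
    using pos[of u] pos[of t] by (subst (asm) mult_le_cancel_left_pos) (auto simp: C_def D_def)
  then have rx: "r * (1 / 2 + Psi x) \<le> 1 / 2 - Psi x"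
    using pos[of x] by (intro power2_le_imp_le[of "r * (1 / 2 + Psi x)"]) auto
  have "r * (sd u * sd t) - JJ x y r \<le> r * (sd x)\<^sup>2 - JJ x 0 r"
    unfolding xy by (rule loss_le_diagonal[OF r x])
  also have "\<dots> \<le> curve_loss tm"
  proof (cases "r \<le> 5 / 11")
    case True
    then show ?thesis
      using diagonal_loss_small_corr[OF r(1) True x rx] curve_loss_maximum_ge[OF tm_max] by simp
  next
    case False
    then obtain s where "0 < s" "2 * Psi s \<le> 3 / 8" "r * (sd x)\<^sup>2 - JJ x 0 r \<le> curve_loss s"
      using diagonal_loss_le_curve_loss[OF r _ x rx] by auto
    then show ?thesis
      using tm_max[of s] by simp
  qed
  finally show ?thesis by (simp add: x_def y_def)
qed

text \<open>Marginal bounds, also for infinite thresholds. The second concerns correlation 0, where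
  the second variable is \<open>snd z\<close> itself.\<close>

lemma Phi2_le:
  assumes "0 \<le> p" "p \<le> 1"
  shows "Phi2 \<rho> (Phi_inv p) y \<le> p" and "Phi2 0 y (Phi_inv p) \<le> p"
proof -
  interpret M: prob_space std_normal by (rule prob_space_std_normal)
  interpret P: pair_prob_space std_normal std_normal ..
  have le: "measure std_normal {v. ereal v \<le> Phi_inv p} \<le> p"
  proof -
    consider "p = 0" | "p = 1" | "0 < p" "p < 1" using assms by linarith
    then show ?thesis
    proof cases
      case 3
      then obtain v where "Phi v = p" by (rule Phi_surj)
      then show ?thesis
        using Phi_inv_Phi[of v] by (simp add: Phi_def atMost_def)
    qed (auto simp: Phi_inv_def)
  qed
  have A: "{v. ereal v \<le> a} \<in> sets std_normal" for a
    by simp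
  have times: "measure (std_normal \<Otimes>\<^sub>M std_normal) (X \<times> Y) = measure std_normal X * measure std_normal Y"
    if "X \<in> sets borel" "Y \<in> sets borel" for X Y
    using that by (simp add: measure_def M.emeasure_pair_measure_Times enn2real_mult)
  have "Phi2 \<rho> (Phi_inv p) y \<le> measure (std_normal \<Otimes>\<^sub>M std_normal) ({v. ereal v \<le> Phi_inv p} \<times> UNIV)"
    unfolding Phi2_def by (intro P.finite_measure_mono pair_measureI A) auto
  also have "\<dots> = measure std_normal {v. ereal v \<le> Phi_inv p} * measure std_normal UNIV"
    by (intro times) auto
  finally show "Phi2 \<rho> (Phi_inv p) y \<le> p"
    using le M.prob_space by simp
  have "Phi2 0 y (Phi_inv p) \<le> measure (std_normal \<Otimes>\<^sub>M std_normal) (UNIV \<times> {v. ereal v \<le> Phi_inv p})"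
    unfolding Phi2_def by (intro P.finite_measure_mono pair_measureI A) auto
  also have "\<dots> = measure std_normal UNIV * measure std_normal {v. ereal v \<le> Phi_inv p}"
    by (intro times) auto
  finally show "Phi2 0 y (Phi_inv p) \<le> p"
    using le M.prob_space by simp
qed

text \<open>At correlation \<open>- 1\<close> the two conditions force \<open>fst z = t\<close>, a
  null event.\<close>

lemma Phi2_minus_1_le: "Phi2 (- 1) (ereal t) (ereal (- t)) \<le> 0"
proof -
  interpret M: prob_space std_normal by (rule prob_space_std_normal)
  interpret P: pair_prob_space std_normal std_normal ..
  have "measure std_normal {t} = 0"
    by (simp add: measure_std_normal set_lebesgue_integral_def)
      (rule integral_eq_zero_AE, rule eventually_mono[OF AE_lborel_singleton[of t]], simp)
  have "Phi2 (- 1) (ereal t) (ereal (- t)) \<le> measure (std_normal \<Otimes>\<^sub>M std_normal) ({t} \<times> UNIV)"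
    unfolding Phi2_def by (intro P.finite_measure_mono pair_measureI) auto
  also have "\<dots> = measure std_normal {t} * measure std_normal UNIV"
    by (simp add: measure_def M.emeasure_pair_measure_Times enn2real_mult)
  finally show ?thesis
    using \<open>measure std_normal {t} = 0\<close> by simp
qed

section \<open>From configurations to thresholds\<close>

lemma obtain_threshold:
  assumes "\<bar>b\<bar> < 1"
  obtains t where "b = 2 * Psi t" "Phi_inv ((1 + b) / 2) = ereal t"
proof -
  obtain t where "Phi t = (1 + b) / 2"
    using assms by (auto intro: Phi_surj[of "(1 + b) / 2"])
  then have "b = 2 * Psi t" "Phi_inv ((1 + b) / 2) = ereal t"
    unfolding \<open>Phi t = (1 + b) / 2\<close>[symmetric] Phi_inv_Phi
    using \<open>Phi t = (1 + b) / 2\<close> by (simp_all add: Psi_def)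
  then show ?thesis by (rule that)
qed

lemma sqrt_prod_eq_sd:
  "sqrt ((1 - (2 * Psi u)\<^sup>2) * (1 - (2 * Psi t)\<^sup>2)) = 4 * (sd u * sd t)"
proof -
  have "(1 - (2 * Psi u)\<^sup>2) * (1 - (2 * Psi t)\<^sup>2) = (4 * (sd u * sd t))\<^sup>2"
    unfolding power_mult_distrib sd_sq by (simp add: field_simps)
  then show ?thesis
    using sd_pos[of u] sd_pos[of t] by (intro real_sqrt_unique) auto
qed

text \<open>Solving the correlation for \<open>b12\<close> and inserting it into
  \<open>Value\<close> cancels \<open>Phi u * Phi t\<close> and all linear terms; \<open>c\<close>
  is the sign of the correlation and \<open>r\<close> its size.\<close>

lemma f_cfg_eq:
  assumes u: "Phi_inv ((1 + 2 * Psi u) / 2) = ereal u" and t: "Phi_inv ((1 + 2 * Psi t) / 2) = ereal t"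
    and r: "0 \<le> r" "r < 1" and c: "c\<^sup>2 = 1" and rho: "rho_cfg (2 * Psi u) (2 * Psi t) b12 = c * r"
  shows "f_cfg (2 * Psi u) (2 * Psi t) b12
    = c * (r * (sd u * sd t) - JJ ((u - c * t) / 2) ((u + c * t) / 2) r)"
proof -
  have S: "0 < sd u * sd t" using sd_pos by simp
  have b12: "b12 = 4 * Psi u * Psi t + 4 * (c * r) * (sd u * sd t)"
  proof -
    have "(b12 - 2 * Psi u * (2 * Psi t)) / (4 * (sd u * sd t)) = c * r"
      using rho S unfolding rho_cfg_def sqrt_prod_eq_sd by (auto split: if_splits)
    then have "b12 - 2 * Psi u * (2 * Psi t) = c * r * (4 * (sd u * sd t))"
      using sd_pos[of u] sd_pos[of t] by (subst (asm) divide_eq_eq) auto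
    then show ?thesis by simp
  qed
  show ?thesis
  proof -
    let ?J = "JJ ((u - c * t) / 2) ((u + c * t) / 2) r"
    have "f_cfg (2 * Psi u) (2 * Psi t) b12 = 1 - (Phi u * Phi t + c * ?J) - Value (2 * Psi u) (2 * Psi t) b12"
      unfolding f_cfg_def rho u t Phi2_eq_Phi_Phi_JJ[OF r c] ..
    also have "Value (2 * Psi u) (2 * Psi t) b12
        = (3 - 2 * Psi u - 2 * Psi t - (4 * Psi u * Psi t + 4 * (c * r) * (sd u * sd t))) / 4"
      by (simp only: Value_def b12)
    also have "1 - (Phi u * Phi t + c * ?J) - \<dots> = c * (r * (sd u * sd t) - ?J)"
      by (simp add: Psi_def field_simps)
    finally show ?thesis .
  qed
qed

text \<open>At \<open>b1\<close> or \<open>b2\<close> equal to 1 or -1 the triangle inequalities fix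
  \<open>b12\<close>, and \<open>1 - Value\<close> becomes the smaller marginal probability, which
  bounds \<open>Phi2\<close>.\<close>

lemma feasible_degenerate:
  assumes "feasible b1 b2 b12" and "\<not> (\<bar>b1\<bar> < 1 \<and> \<bar>b2\<bar> < 1)"
  shows "0 \<le> f_cfg b1 b2 b12"
proof -
  have b: "b1 \<in> {- 1..1}" "b2 \<in> {- 1..1}" "- 1 + \<bar>b1 + b2\<bar> \<le> b12" "b12 \<le> 1 - \<bar>b1 - b2\<bar>"
    using assms(1) by (auto simp: feasible_def)
  then have ext: "b1 = 1 \<or> b1 = - 1 \<or> b2 = 1 \<or> b2 = - 1"
    using assms(2) by auto
  then have rho: "rho_cfg b1 b2 b12 = 0"
    by (auto simp: rho_cfg_def)
  have p: "0 \<le> (1 + b1) / 2" "(1 + b1) / 2 \<le> 1" "0 \<le> (1 + b2) / 2" "(1 + b2) / 2 \<le> 1"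
    using b by auto
  have "Phi2 0 (Phi_inv ((1 + b1) / 2)) (Phi_inv ((1 + b2) / 2)) \<le> (1 + b1) / 2"
    "Phi2 0 (Phi_inv ((1 + b1) / 2)) (Phi_inv ((1 + b2) / 2)) \<le> (1 + b2) / 2"
    using Phi2_le p by blast+
  moreover have "1 - Value b1 b2 b12 = min ((1 + b1) / 2) ((1 + b2) / 2)"
    using ext b by (auto simp: Value_def diff_divide_distrib)
  ultimately show ?thesis
    unfolding f_cfg_def rho by linarith
qed

section \<open>Correlations of absolute value at least 1, and the lower bound for all
  configurations\<close>

lemma le_of_le_sqrt_prod:
  fixes p q p' q' :: real
  assumes "0 < p" "0 < q" "0 < p'" "0 < q'" "sqrt (p * q * (p' * q')) \<le> p * q"
  shows "p' * q' \<le> p * q"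
proof -
  have "p * q * (p' * q') = (sqrt (p * q * (p' * q')))\<^sup>2"
    using assms by simp
  also have "\<dots> \<le> (p * q)\<^sup>2"
    using assms by (intro power_mono) auto
  finally have "(p * q) * (p' * q') \<le> (p * q) * (p * q)"
    by (simp add: power2_eq_square)
  then show ?thesis
    using assms by (subst (asm) mult_le_cancel_left_pos) auto
qed

text \<open>The denominator \<open>S\<close> is the geometric mean of
  \<open>(1 - b1) * (1 + b2)\<close> and \<open>(1 + b1) * (1 - b2)\<close>. The triangle
  inequalities bound \<open>b12 - b1 * b2\<close> by both, so correlation at least 1 puts
  \<open>S\<close> below both and forces them to be equal. For the lower end the factors are paired
  the other way.\<close>

lemma extreme_correlation:
  assumes "feasible b1 b2 b12" and b: "\<bar>b1\<bar> < 1" "\<bar>b2\<bar> < 1"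
  shows "1 \<le> rho_cfg b1 b2 b12 \<Longrightarrow> b1 = b2 \<and> b12 = 1"
    and "rho_cfg b1 b2 b12 \<le> - 1 \<Longrightarrow> b2 = - b1 \<and> b12 = - 1"
proof -
  have tri: "- 1 + \<bar>b1 + b2\<bar> \<le> b12" "b12 \<le> 1 - \<bar>b1 - b2\<bar>"
    using assms(1) by (auto simp: feasible_def)
  define S where "S = sqrt ((1 - b1\<^sup>2) * (1 - b2\<^sup>2))"
  have S: "0 < S"
    using b by (simp add: S_def abs_square_less_1)
  have fac: "1 - v\<^sup>2 = (1 - v) * (1 + v)" for v :: real
    by (simp add: power2_eq_square algebra_simps)
  have S_eq: "S = sqrt ((1 - b1) * (1 + b2) * ((1 + b1) * (1 - b2)))"
    "S = sqrt ((1 + b1) * (1 - b2) * ((1 - b1) * (1 + b2)))"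
    "S = sqrt ((1 - b1) * (1 - b2) * ((1 + b1) * (1 + b2)))"
    "S = sqrt ((1 + b1) * (1 + b2) * ((1 - b1) * (1 - b2)))"
    unfolding S_def fac by (simp_all only: mult_ac)
  have rho: "rho_cfg b1 b2 b12 = (b12 - b1 * b2) / S"
    using S by (simp add: rho_cfg_def S_def)
  have pos: "0 < 1 - b1" "0 < 1 - b2" "0 < 1 + b1" "0 < 1 + b2"
    using b by auto
  show "b1 = b2 \<and> b12 = 1" if "1 \<le> rho_cfg b1 b2 b12"
  proof -
    have le: "S \<le> b12 - b1 * b2" using that S by (simp add: rho le_divide_eq)
    have "S \<le> (1 - b1) * (1 + b2)" "S \<le> (1 + b1) * (1 - b2)"
      using le tri by (auto simp: algebra_simps abs_le_iff)
    then have "(1 + b1) * (1 - b2) \<le> (1 - b1) * (1 + b2)" "(1 - b1) * (1 + b2) \<le> (1 + b1) * (1 - b2)"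
      using le_of_le_sqrt_prod[of "1 - b1" "1 + b2" "1 + b1" "1 - b2"]
        le_of_le_sqrt_prod[of "1 + b1" "1 - b2" "1 - b1" "1 + b2"] pos
      unfolding S_eq(1,2)[symmetric] by blast+
    then have "b1 = b2" by (simp add: algebra_simps)
    moreover have "S = 1 - b1\<^sup>2"
      using pos \<open>b1 = b2\<close> b by (simp add: S_def abs_square_le_1)
    ultimately show ?thesis
      using le tri by (simp add: power2_eq_square)
  qed
  show "b2 = - b1 \<and> b12 = - 1" if "rho_cfg b1 b2 b12 \<le> - 1"
  proof -
    have le: "S \<le> b1 * b2 - b12" using that S by (simp add: rho divide_le_eq)
    have "S \<le> (1 - b1) * (1 - b2)" "S \<le> (1 + b1) * (1 + b2)"
      using le tri by (auto simp: algebra_simps abs_le_iff)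
    then have "(1 + b1) * (1 + b2) \<le> (1 - b1) * (1 - b2)" "(1 - b1) * (1 - b2) \<le> (1 + b1) * (1 + b2)"
      using le_of_le_sqrt_prod[of "1 - b1" "1 - b2" "1 + b1" "1 + b2"]
        le_of_le_sqrt_prod[of "1 + b1" "1 + b2" "1 - b1" "1 - b2"] pos
      unfolding S_eq(3,4)[symmetric] by blast+
    then have "b2 = - b1" by (simp add: algebra_simps)
    moreover have "S = 1 - b1\<^sup>2"
      using pos \<open>b2 = - b1\<close> b by (simp add: S_def abs_square_le_1)
    ultimately show ?thesis
      using le tri by (simp add: power2_eq_square)
  qed
qed

text \<open>Because \<open>curve_loss tm\<close> is positive, \<open>0 <= f_cfg b1 b2 b12\<close>
  suffices except for correlations strictly between -1 and 0.\<close>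

lemma f_cfg_ge:
  assumes feas: "feasible b1 b2 b12"
    and tm_max: "\<And>s. 0 < s \<Longrightarrow> 2 * Psi s \<le> 3 / 8 \<Longrightarrow> curve_loss s \<le> curve_loss tm"
  shows "- curve_loss tm \<le> f_cfg b1 b2 b12"
proof -
  have tm0: "0 \<le> curve_loss tm"
    using curve_loss_maximum_ge[OF tm_max] by simp
  show ?thesis
  proof (cases "\<bar>b1\<bar> < 1 \<and> \<bar>b2\<bar> < 1")
    case False
    then show ?thesis
      using feasible_degenerate[OF feas] tm0 by simp
  next
    case True
    then have b: "\<bar>b1\<bar> < 1" "\<bar>b2\<bar> < 1" by auto
    obtain u where u: "b1 = 2 * Psi u" "Phi_inv ((1 + b1) / 2) = ereal u"
      using b(1) by (rule obtain_threshold)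
    obtain t where t: "b2 = 2 * Psi t" "Phi_inv ((1 + b2) / 2) = ereal t"
      using b(2) by (rule obtain_threshold)
    define \<rho> where "\<rho> = rho_cfg b1 b2 b12"
    consider "1 \<le> \<rho>" | "\<rho> \<le> - 1" | "0 \<le> \<rho>" "\<rho> < 1" | "- 1 < \<rho>" "\<rho> < 0"
      by fastforce
    then show ?thesis
    proof cases
      case 1
      then have eq: "b1 = b2" "b12 = 1"
        using extreme_correlation(1)[OF feas b] by (auto simp: \<rho>_def)
      have "Phi2 \<rho> (Phi_inv ((1 + b1) / 2)) (Phi_inv ((1 + b2) / 2)) \<le> (1 + b1) / 2"
        using b by (intro Phi2_le) auto
      moreover have "Value b1 b2 b12 = 1 - (1 + b1) / 2"
        by (simp add: Value_def eq field_simps)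
      ultimately show ?thesis
        using tm0 unfolding f_cfg_def \<rho>_def by linarith
    next
      case 2
      then have eq: "b2 = - b1" "b12 = - 1"
        using extreme_correlation(2)[OF feas b] by (auto simp: \<rho>_def)
      then have "Psi t = Psi (- u)" using u t by simp
      then have "t = - u" by (simp add: Psi_def Phi_inj)
      have "sqrt ((1 - b1\<^sup>2) * (1 - b2\<^sup>2)) = 1 - b1\<^sup>2" "0 < 1 - b1\<^sup>2"
        using eq b by (auto simp: abs_square_le_1 abs_square_less_1)
      then have "\<rho> = - 1"
        by (simp add: \<rho>_def rho_cfg_def eq) (simp add: power2_eq_square field_simps)
      then have "Phi2 \<rho> (Phi_inv ((1 + b1) / 2)) (Phi_inv ((1 + b2) / 2)) \<le> 0"
        using Phi2_minus_1_le[of u] u t \<open>t = - u\<close> by simp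
      moreover have "Value b1 b2 b12 = 1"
        by (simp add: Value_def eq)
      ultimately show ?thesis
        using tm0 unfolding f_cfg_def \<rho>_def by linarith
    next
      case 3
      have "f_cfg b1 b2 b12 = 1 * (\<rho> * (sd u * sd t) - JJ ((u - 1 * t) / 2) ((u + 1 * t) / 2) \<rho>)"
        using u t 3 unfolding u(1) t(1) by (intro f_cfg_eq) (auto simp: \<rho>_def u(1) t(1))
      then show ?thesis
        using JJ_le_sd_mult_sd[OF 3, of u t] tm0 by simp
    next
      case 4
      define r where "r = - \<rho>"
      have r: "0 \<le> r" "r < 1" using 4 by (auto simp: r_def)
      have f: "f_cfg b1 b2 b12 = (- 1) * (r * (sd u * sd t) - JJ ((u - (- 1) * t) / 2) ((u + (- 1) * t) / 2) r)"
        using u t r unfolding u(1) t(1) by (intro f_cfg_eq) (auto simp: \<rho>_def r_def u(1) t(1))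
      have "0 < sd u * sd t" using sd_pos by simp
      then have rs: "4 * (r * (sd u * sd t)) = b1 * b2 - b12"
        unfolding r_def \<rho>_def rho_cfg_def u(1) t(1) sqrt_prod_eq_sd by (auto simp: field_simps)
      have tri: "- 1 + \<bar>b1 + b2\<bar> \<le> b12"
        using feas by (simp add: feasible_def)
      have "r * (sd u * sd t) - JJ ((u + t) / 2) ((u - t) / 2) r \<le> curve_loss tm"
      proof (cases "0 \<le> u + t")
        case True
        have "4 * (r * (sd u * sd t)) \<le> (1 - b1) * (1 - b2)"
          unfolding rs using tri by (simp add: algebra_simps)
        then have "r * (sd u * sd t) \<le> (1 / 2 - Psi u) * (1 / 2 - Psi t)"
          unfolding u(1) t(1) by (simp add: algebra_simps)
        from loss_le_curve_loss_maximum[OF tm_max r True this] show ?thesis .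
      next
        case False
        \<comment> \<open>Changing the sign of both thresholds preserves \<open>sd\<close> and
          \<open>JJ\<close>, and turns the other half of the constraint,
          \<open>- 1 - (b1 + b2) <= b12\<close>, into the case already treated.\<close>
        have "4 * (r * (sd u * sd t)) \<le> (1 + b1) * (1 + b2)"
          unfolding rs using tri by (simp add: algebra_simps)
        then have "r * (sd (- u) * sd (- t)) \<le> (1 / 2 - Psi (- u)) * (1 / 2 - Psi (- t))"
          unfolding u(1) t(1) by (simp add: algebra_simps)
        then have "r * (sd (- u) * sd (- t)) - JJ ((- u + - t) / 2) ((- u - - t) / 2) r \<le> curve_loss tm"
          using False loss_le_curve_loss_maximum[OF tm_max r, of "- u" "- t"] by auto
        moreover have "(- u + - t) / 2 = - ((u + t) / 2)" "(- u - - t) / 2 = - ((u - t) / 2)"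
          by (simp_all add: field_simps)
        ultimately show ?thesis
          by (simp only: sd_minus JJ_minus_left JJ_minus_right)
      qed
      then show ?thesis using f by simp
    qed
  qed
qed

lemma feasible_diagonal:
  assumes b: "0 < b" "b < 1"
  shows "feasible b b (- 1 + 2 * b)"
proof -
  define s where "s = sqrt (1 - b\<^sup>2)"
  have s: "0 < s" "s\<^sup>2 = 1 - b\<^sup>2"
    using b abs_square_less_1[of b] by (auto simp: s_def)
  \<comment> \<open>\<open>w\<close> is forced by \<open>b^2 + s * w = 2 * b - 1\<close>. The last
    coordinate of \<open>v2\<close> then gives it norm 1, which requires
    \<open>w^2 <= s^2\<close>.\<close>
  define w where "w = - (1 - b)\<^sup>2 / s"
  have "w\<^sup>2 * s\<^sup>2 = ((1 - b)\<^sup>2)\<^sup>2"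
    using s(1) by (simp add: w_def power_divide)
  then have "w\<^sup>2 * (1 + b) * (1 - b) = (1 - b) ^ 3 * (1 - b)"
    unfolding s(2) by (simp add: power2_eq_square power3_eq_cube algebra_simps)
  then have w2: "w\<^sup>2 * (1 + b) = (1 - b) ^ 3"
    using b by simp
  have "w\<^sup>2 * (1 + b) \<le> s\<^sup>2 * (1 + b)"
  proof -
    have "(1 - b) * (1 - b)\<^sup>2 \<le> (1 - b) * (1 + b)\<^sup>2"
      using b by (intro mult_left_mono power_mono) auto
    then show ?thesis
      unfolding w2 s(2) by (simp add: power2_eq_square power3_eq_cube algebra_simps)
  qed
  then have ws: "w\<^sup>2 \<le> s\<^sup>2" using b by simp
  have ip: "(vector [x, y, z] :: real ^ 3) \<bullet> vector [x', y', z'] = x * x' + y * y' + z * z'" for x y z x' y' z' :: real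
    by (simp add: inner_vec_def sum_3)
  define v0 v1 v2 :: "real ^ 3" where "v0 = vector [1, 0, 0]" and "v1 = vector [b, s, 0]"
    and "v2 = vector [b, w, sqrt (s\<^sup>2 - w\<^sup>2)]"
  have "norm v0 = 1" "norm v1 = 1" "norm v2 = 1" "v0 \<bullet> v1 = b" "v0 \<bullet> v2 = b"
    using s ws by (simp_all add: v0_def v1_def v2_def norm_eq_1 ip power2_eq_square[symmetric])
  moreover have "v1 \<bullet> v2 = - 1 + 2 * b"
  proof -
    have "s * w = - (1 - b)\<^sup>2" using s(1) by (simp add: w_def)
    then show ?thesis
      by (simp add: v1_def v2_def ip) (simp add: power2_eq_square algebra_simps)
  qed
  ultimately show ?thesis
    unfolding feasible_def using b by auto
qed

theorem theorem5p5:
  fixes b0 \<epsilon> :: real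
  assumes "b0 = 0.1489442" and "\<epsilon> = 1 / 10^6"
  shows "\<exists>bs :: real. \<bar>bs\<bar> \<in> {b0 - \<epsilon> .. b0 + \<epsilon>} \<and>
           feasible bs bs (-1 + 2 * \<bar>bs\<bar>) \<and>
           (\<forall>b1 b2 b12. feasible b1 b2 b12 \<longrightarrow>
              f_cfg bs bs (-1 + 2 * \<bar>bs\<bar>) \<le> f_cfg b1 b2 b12)"
proof -
  obtain t where t: "0 < t" "0.148943397 \<le> 2 * Psi t" "2 * Psi t \<le> 0.148945003"
    and max: "\<And>s. 0 < s \<Longrightarrow> 2 * Psi s \<le> 3 / 8 \<Longrightarrow> curve_loss s \<le> curve_loss t"
    by (rule curve_loss_maximum) blast
  define b where "b = 2 * Psi t"
  have b: "0 < b" "b < 1" using t by (simp_all add: b_def)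
  have rho: "rho_cfg b b (- 1 + 2 * b) = (- 1) * curve_corr t"
  proof -
    have "sqrt ((1 - b\<^sup>2) * (1 - b\<^sup>2)) = (1 - b) * (1 + b)"
      using b by (simp add: abs_square_le_1) (simp add: power2_eq_square algebra_simps)
    moreover have "- 1 + 2 * b - b * b = - ((1 - b) * (1 - b))"
      by (simp add: algebra_simps)
    moreover have "0 < sqrt ((1 - b\<^sup>2) * (1 - b\<^sup>2))"
      using b abs_square_less_1[of b] by simp
    ultimately have "rho_cfg b b (- 1 + 2 * b) = - ((1 - b) * (1 - b)) / ((1 - b) * (1 + b))"
      unfolding rho_cfg_def by simp
    also have "\<dots> = (- 1) * curve_corr t"
      using b by (simp add: curve_corr_def b_def[symmetric] minus_divide_left)
    finally show ?thesis .
  qed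
  have inv: "Phi_inv ((1 + 2 * Psi t) / 2) = ereal t"
    using Phi_inv_Phi[of t] by (simp add: Psi_def)
  \<comment> \<open>Negative correlation, \<open>c = - 1\<close>, with equal thresholds gives the
    point \<open>x = t\<close>, \<open>y = 0\<close> of \<open>curve_loss\<close>.\<close>
  have "f_cfg b b (- 1 + 2 * b)
      = (- 1) * (curve_corr t * (sd t * sd t) - JJ ((t - (- 1) * t) / 2) ((t + (- 1) * t) / 2) (curve_corr t))"
    unfolding b_def
    by (rule f_cfg_eq[OF inv inv _ curve_corr_bounds(2)[OF t(1)] _ rho[unfolded b_def]])
      (use curve_corr_bounds(1)[OF t(1)] in auto)
  also have "curve_corr t * (sd t * sd t) = (1 / 2 - Psi t)\<^sup>2"
  proof -
    have "sd t * sd t = (1 - b) * (1 + b) / 4"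
      using sd_sq[of t] by (simp add: b_def power2_eq_square field_simps)
    moreover have "(1 - b) / (1 + b) * ((1 - b) * (1 + b) / 4) = (1 / 2 - b / 2)\<^sup>2"
      using b by (simp add: power2_eq_square field_simps)
    moreover have "curve_corr t = (1 - b) / (1 + b)" "Psi t = b / 2"
      by (simp_all add: curve_corr_def b_def)
    ultimately show ?thesis by (simp only:)
  qed
  finally have f: "f_cfg b b (- 1 + 2 * b) = - curve_loss t"
    by (simp add: curve_loss_def)
  have "\<bar>b\<bar> \<in> {b0 - \<epsilon> .. b0 + \<epsilon>}"
    using t assms by (simp add: b_def)
  moreover have "feasible b b (- 1 + 2 * \<bar>b\<bar>)"
    using feasible_diagonal[OF b] b by simp
  moreover have "f_cfg b b (- 1 + 2 * \<bar>b\<bar>) \<le> f_cfg b1 b2 b12" if "feasible b1 b2 b12" for b1 b2 b12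
    using f_cfg_ge[OF that max] f b by simp
  ultimately show ?thesis by blast
qed

end
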